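(* For every integer $n\ge1$, the number of tatami tilings of the $n\times n$ grid with exactly $n$ monomers is $T(n,n,n)=n2^{n-1}$.
   Context: A tatami tiling of the $r\times c$ rectangular grid is a tiling by monomers ($1\times1$ tiles) and dimers ($1\times2$ or $2\times1$ tiles) such that no point is a corner of four distinct tiles. $T(r,c,m)$ denotes the number of tatami tilings of the $r\times c$ grid with exactly $m$ monomers. *)

theory Defs
  imports Main
begin

definition grid :: "nat \<Rightarrow> nat \<Rightarrow> (nat \<times> nat) set" where
  "grid r c = {(i, j). i < r \<and> j < c}"

definition monomer :: "nat \<times> nat \<Rightarrow> (nat \<times> nat) set" where
  "monomer x = {x}"

definition hdimer :: "nat \<times> nat \<Rightarrow> (nat \<times> nat) set" where
  "hdimer x = {x, (fst x, Suc (snd x))}"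

definition vdimer :: "nat \<times> nat \<Rightarrow> (nat \<times> nat) set" where
  "vdimer x = {x, (Suc (fst x), snd x)}"

definition tiles :: "nat \<Rightarrow> nat \<Rightarrow> (nat \<times> nat) set set" where
  "tiles r c = {t. (\<exists>x. t = monomer x \<or> t = hdimer x \<or> t = vdimer x) \<and> t \<subseteq> grid r c}"

definition is_tiling :: "nat \<Rightarrow> nat \<Rightarrow> (nat \<times> nat) set set \<Rightarrow> bool" where
  "is_tiling r c P \<longleftrightarrow> P \<subseteq> tiles r c \<and> (\<forall>x \<in> grid r c. \<exists>!t. t \<in> P \<and> x \<in> t)"

text \<open>Tatami condition: no lattice point is a corner of four distinct tiles. Only interior
  lattice points (i,j) with 0<i<r, 0<j<c can be such corners; the four cells around such a point
  are (i-1,j-1), (i-1,j), (i,j-1), (i,j).\<close>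
definition is_tatami :: "nat \<Rightarrow> nat \<Rightarrow> (nat \<times> nat) set set \<Rightarrow> bool" where
  "is_tatami r c P \<longleftrightarrow> is_tiling r c P \<and>
     (\<forall>i j. 0 < i \<and> i < r \<and> 0 < j \<and> j < c \<longrightarrow>
        \<not> (\<exists>t1\<in>P. \<exists>t2\<in>P. \<exists>t3\<in>P. \<exists>t4\<in>P.
              (i - 1, j - 1) \<in> t1 \<and> (i - 1, j) \<in> t2 \<and> (i, j - 1) \<in> t3 \<and> (i, j) \<in> t4 \<and>
              t1 \<noteq> t2 \<and> t1 \<noteq> t3 \<and> t1 \<noteq> t4 \<and> t2 \<noteq> t3 \<and> t2 \<noteq> t4 \<and> t3 \<noteq> t4))"

definition num_monomers :: "(nat \<times> nat) set set \<Rightarrow> nat" where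
  "num_monomers P = card {t \<in> P. card t = 1}"

definition T :: "nat \<Rightarrow> nat \<Rightarrow> nat \<Rightarrow> nat" where
  "T r c m = card {P. is_tatami r c P \<and> num_monomers P = m}"

end

theory Submission
  imports Defs
begin

text \<open>
  Every dimer covers the two lattice points at the middle of its long sides, and the tatami
  condition says that every interior point is covered.  For \<open>1 \<le> k < n\<close> consider the tilted
  rectangle with corners \<open>(0, k)\<close>, \<open>(k, 0)\<close>, \<open>(n, n - k)\<close>, \<open>(n - k, n)\<close>.  It has one interior
  lattice point more than it contains cells, so one of its corners must be covered by a dimer along
  the boundary of the grid.  With exactly \<open>n\<close> monomers, counting covered points leaves no slack:
  exactly one corner of each rectangle is covered, no point is covered twice, and all monomers lie
  on the boundary.

  Reading each cell as an arrow towards the other cell of its dimer (monomers point out of the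
  grid), it follows that the arrows have a constant sign along every diagonal and every
  antidiagonal.  These signs are determined by which corner is covered for each \<open>k\<close>, encoded by two
  bits \<open>q k\<close> and \<open>r k\<close>.  The words that occur are those for which every repetition in \<open>r\<close> comes
  strictly before every repetition in \<open>q\<close>, and there are \<open>n 2 ^ (n - 1)\<close> of them.
\<close>

subsection \<open>Rigidity of tilings with a maximal number of monomers\<close>

text \<open>The signs are constant because a dimer covering an interior point contains exactly one
  of the two cells that meet there along a given diagonal direction. With every interior point
  covered exactly once, one of these two cells points along the diagonal towards the point and the
  other away from it, so both carry the same sign. The order of repetitions comes from parity. A
  repetition of \<open>q\<close> at \<open>k\<close> gives the diagonals \<open>k\<close> and
  \<open>- k\<close> opposite signs; their distance is even, so two neighbouring diagonals between
  them agree. A repetition of \<open>r\<close> at \<open>l\<close> does the same for the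
  antidiagonals \<open>l\<close> and \<open>2 * n - 2 - l\<close>. For \<open>k \<le> l\<close> the
  two agreeing pairs cross inside the grid, where the arrows cannot be matched into dimers. The
  number of words comes from appending one pair of bits: with \<open>W n\<close> words, of which
  \<open>2 ^ n\<close> have no repetition in \<open>q\<close>, one gets
  \<open>W (n + 1) = 2 * W n + 2 ^ n\<close> for \<open>n \<ge> 2\<close>. This and
  \<open>W 2 = 4\<close> give \<open>n * 2 ^ (n - 1)\<close>.\<close>

text \<open>
  \<open>h i j\<close> stands for a dimer on the cells \<open>(i, j)\<close> and \<open>(i, j + 1)\<close>, and \<open>v i j\<close> for one on \<open>(i, j)\<close>
  and \<open>(i + 1, j)\<close>.  The cell \<open>(i, j)\<close> is the unit square with opposite corners \<open>(i, j)\<close> and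
  \<open>(i + 1, j + 1)\<close>; integer coordinates avoid truncated subtraction at the border.
\<close>

locale tatami =
  fixes n :: int and h v :: "int \<Rightarrow> int \<Rightarrow> bool"
  assumes n_pos: "n \<ge> 1"
    and h_in: "h i j \<Longrightarrow> 0 \<le> i \<and> i < n \<and> 0 \<le> j \<and> j + 1 < n"
    and v_in: "v i j \<Longrightarrow> 0 \<le> i \<and> i + 1 < n \<and> 0 \<le> j \<and> j < n"
    and hh: "h i j \<Longrightarrow> \<not> h i (j + 1)"
    and vv: "v i j \<Longrightarrow> \<not> v (i + 1) j"
    and hv: "h i j \<Longrightarrow> \<not> v i j \<and> \<not> v i (j + 1) \<and> \<not> v (i - 1) j \<and> \<not> v (i - 1) (j + 1)"
    and vertex_covered: "0 < i \<Longrightarrow> i < n \<Longrightarrow> 0 < j \<Longrightarrow> j < n \<Longrightarrow>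
      h (i - 1) (j - 1) \<or> h i (j - 1) \<or> v (i - 1) (j - 1) \<or> v (i - 1) j"
begin

definition uncovered :: "int \<Rightarrow> int \<Rightarrow> bool" where
  "uncovered i j \<longleftrightarrow> 0 \<le> i \<and> i < n \<and> 0 \<le> j \<and> j < n \<and>
     \<not> h i j \<and> \<not> h i (j - 1) \<and> \<not> v i j \<and> \<not> v (i - 1) j"

lemma hh': "h i j \<Longrightarrow> \<not> h i (j - 1)"
  using hh[of i "j - 1"] by auto

lemma vv': "v i j \<Longrightarrow> \<not> v (i - 1) j"
  using vv[of "i - 1" j] by auto

lemma hv': "v i j \<Longrightarrow> \<not> h i j \<and> \<not> h i (j - 1) \<and> \<not> h (i + 1) j \<and> \<not> h (i + 1) (j - 1)"
  using hv[of i j] hv[of i "j - 1"] hv[of "i + 1" j] hv[of "i + 1" "j - 1"] by auto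

text \<open>
  The lattice points strictly inside the \<open>k\<close>-th tilted rectangle, and the cells whose interior
  does not meet its sides.
\<close>

definition inner_vertices :: "int \<Rightarrow> (int \<times> int) set" where
  "inner_vertices k = {(i, j). k < i + j \<and> i + j < 2 * n - k \<and> i - j < k \<and> j - i < k}"

definition inner_cells :: "int \<Rightarrow> (int \<times> int) set" where
  "inner_cells k = {(i, j). k \<le> i + j \<and> i + j \<le> 2 * n - 2 - k \<and> i - j < k \<and> j - i < k}"

lemma finite_inner:
  "finite (inner_vertices k)" "finite (inner_cells k)"
proof -
  have "inner_vertices k \<subseteq> {0..n} \<times> {0..n}" "inner_cells k \<subseteq> {0..n} \<times> {0..n}"
    by (auto simp: inner_vertices_def inner_cells_def)
  then show "finite (inner_vertices k)" "finite (inner_cells k)"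
    by (meson finite_SigmaI finite_atLeastAtMost_int finite_subset)+
qed

text \<open>Compare the levels \<open>i + j\<close>. On levels with the parity of \<open>k\<close>
  the bound on \<open>i - j\<close> leaves \<open>k - 1\<close> positions, on the others
  \<open>k\<close>. The cell levels begin and end with the parity of \<open>k\<close>, the vertex
  levels with the other parity, so the vertices win by one.\<close>

lemma card_inner_cells:
  assumes "1 \<le> k" "k < n"
  shows "card (inner_cells k) < card (inner_vertices k)"
proof -
  \<comment> \<open>Odd levels stay in place, even levels move up by two. The top even level has no
    room left and moves to the top vertex level, which is longer by one; the vertex missed there is
    \<open>(n - 1, n - k)\<close>.\<close>
  define f where "f = (\<lambda>(i, j). if i + j = 2 * n - 2 - k then (i, j + 1)
     else if even (i + j - k) then (i + 1, j + 1) else (i, j :: int))"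
  have "inj_on f (inner_cells k)"
  proof (rule inj_onI)
    fix c d assume "c \<in> inner_cells k" "d \<in> inner_cells k" "f c = f d"
    moreover obtain i j a b where "c = (i, j)" "d = (a, b)" by fastforce
    ultimately show "c = d"
      by (simp add: f_def inner_cells_def split: if_splits) presburger+
  qed
  then have "card (inner_cells k) = card (f ` inner_cells k)"
    by (simp add: card_image)
  moreover have "f ` inner_cells k \<subseteq> inner_vertices k - {(n - 1, n - k)}"
  proof (rule image_subsetI)
    fix c assume "c \<in> inner_cells k"
    moreover obtain i j where "c = (i, j)" by fastforce
    ultimately show "f c \<in> inner_vertices k - {(n - 1, n - k)}"
      by (simp add: f_def inner_cells_def inner_vertices_def split: if_splits) presburger+
  qed
  moreover have "(n - 1, n - k) \<in> inner_vertices k"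
    using assms by (auto simp: inner_vertices_def)
  ultimately have "f ` inner_cells k \<subset> inner_vertices k" by auto
  then show ?thesis
    using psubset_card_mono[OF finite_inner(1)] \<open>card (inner_cells k) = _\<close> by metis
qed

definition outlets :: "int \<Rightarrow> (int \<times> int) set" where
  "outlets k = {w. w = (1, k) \<and> h 0 (k - 1) \<or> w = (k, 1) \<and> v (k - 1) 0 \<or>
     w = (n - 1, n - k) \<and> h (n - 1) (n - k - 1) \<or> w = (n - k, n - 1) \<and> v (n - k - 1) (n - 1)}"

text \<open>
  A dimer with two inner cells covers two inner vertices and gives one of its cells to each.  A
  dimer crossing the side of the rectangle covers one inner vertex, which takes its inner cell.
  Only a dimer through a corner (an outlet) covers an inner vertex without having an inner cell.
\<close>

lemma card_inner_le:
  assumes "1 \<le> k" "k < n"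
  shows "card (inner_vertices k - outlets k) \<le> card {c \<in> inner_cells k. \<not> uncovered (fst c) (snd c)}"
proof -
  \<comment> \<open>Normally a cell goes to the point covered by its dimer that is a corner of the
    cell on its main diagonal. The last two lines serve dimers crossing a side: the point that would
    take the outer cell takes the inner one instead.\<close>
  define rel where "rel = (\<lambda>w c. case (w, c) of ((i, j), (a, b)) \<Rightarrow>
    (i, j) = (a, b) \<and> (h a (b - 1) \<or> v (a - 1) b) \<or>
    (i, j) = (a + 1, b + 1) \<and> (h a b \<or> v a b) \<or>
    (i, j) = (a, b + 1) \<and> (h a b \<and> (a, b + 1) \<notin> inner_cells k \<or> v (a - 1) b \<and> (a - 1, b) \<notin> inner_cells k) \<or>
    (i, j) = (a + 1, b) \<and> (h a (b - 1) \<and> (a, b - 1) \<notin> inner_cells k \<or> v a b \<and> (a + 1, b) \<notin> inner_cells k))"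
  show ?thesis
  proof (rule card_le_if_inj_on_rel[where r = rel])
    show "finite {c \<in> inner_cells k. \<not> uncovered (fst c) (snd c)}"
      using finite_inner by simp
  next
    fix w assume w: "w \<in> inner_vertices k - outlets k"
    obtain i j where ij: "w = (i, j)" by fastforce
    have b: "k < i + j" "i + j < 2 * n - k" "i - j < k" "j - i < k"
      using w by (auto simp: ij inner_vertices_def)
    have "0 < i" "i < n" "0 < j" "j < n" using b by auto
    then consider "h (i - 1) (j - 1)" | "h i (j - 1)" | "v (i - 1) (j - 1)" | "v (i - 1) j"
      using vertex_covered by blast
    then show "\<exists>c. c \<in> {c \<in> inner_cells k. \<not> uncovered (fst c) (snd c)} \<and> rel w c"
    proof cases
      case 1
      have "(i - 1, j - 1) \<in> inner_cells k \<or> (i - 1, j) \<in> inner_cells k"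
      proof (rule ccontr)
        assume "\<not> ?thesis"
        then have "i = 1" "j = k" using b unfolding inner_cells_def by auto
        then show False using 1 w by (auto simp: ij outlets_def)
      qed
      then show ?thesis
        using 1 
        by (cases "(i - 1, j - 1) \<in> inner_cells k"; intro exI[of _ "(i - 1, if (i - 1, j - 1) \<in> inner_cells k then j - 1 else j)"])
           (auto simp: rel_def ij uncovered_def)
    next
      case 2
      have "(i, j) \<in> inner_cells k \<or> (i, j - 1) \<in> inner_cells k"
      proof (rule ccontr)
        assume "\<not> ?thesis"
        then have "i = n - 1" "j = n - k" using b unfolding inner_cells_def by auto
        then show False using 2 w by (auto simp: ij outlets_def)
      qed
      then show ?thesis
        using 2
        by (cases "(i, j) \<in> inner_cells k"; intro exI[of _ "(i, if (i, j) \<in> inner_cells k then j else j - 1)"])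
           (auto simp: rel_def ij uncovered_def)
    next
      case 3
      have "(i - 1, j - 1) \<in> inner_cells k \<or> (i, j - 1) \<in> inner_cells k"
      proof (rule ccontr)
        assume "\<not> ?thesis"
        then have "i = k" "j = 1" using b unfolding inner_cells_def by auto
        then show False using 3 w by (auto simp: ij outlets_def)
      qed
      then show ?thesis
        using 3
        by (cases "(i - 1, j - 1) \<in> inner_cells k"; intro exI[of _ "(if (i - 1, j - 1) \<in> inner_cells k then i - 1 else i, j - 1)"])
           (auto simp: rel_def ij uncovered_def)
    next
      case 4
      have "(i, j) \<in> inner_cells k \<or> (i - 1, j) \<in> inner_cells k"
      proof (rule ccontr)
        assume "\<not> ?thesis"
        then have "i = n - k" "j = n - 1" using b unfolding inner_cells_def by auto
        then show False using 4 w by (auto simp: ij outlets_def)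
      qed
      then show ?thesis
        using 4
        by (cases "(i, j) \<in> inner_cells k"; intro exI[of _ "(if (i, j) \<in> inner_cells k then i else i - 1, j)"])
           (auto simp: rel_def ij uncovered_def)
    qed
  next
    fix w w' c
    assume w: "w \<in> inner_vertices k - outlets k" "w' \<in> inner_vertices k - outlets k"
      and c: "c \<in> {c \<in> inner_cells k. \<not> uncovered (fst c) (snd c)}" and r: "rel w c" "rel w' c"
    obtain i j where ij: "w = (i, j)" by fastforce
    obtain i' j' where ij': "w' = (i', j')" by fastforce
    obtain a b where ab: "c = (a, b)" by fastforce
    note off = hh[of a b] hh'[of a b] vv[of a b] vv'[of a b] hv[of a b] hv'[of a b]
      hh[of a "b - 1"] hv[of a "b - 1"] vv[of "a - 1" b] hv'[of "a - 1" b]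
    have bnd: "k < i + j" "i + j < 2 * n - k" "i - j < k" "j - i < k"
      "k < i' + j'" "i' + j' < 2 * n - k" "i' - j' < k" "j' - i' < k"
      using w by (auto simp: ij ij' inner_vertices_def)
    from c consider "h a b" | "h a (b - 1)" | "v a b" | "v (a - 1) b"
      by (auto simp: ab uncovered_def inner_cells_def)
    then show "w = w'"
    proof cases
      case 1
      then have "\<not> h a (b - 1)" "\<not> v a b" "\<not> v (a - 1) b" using off by auto
      then show ?thesis using r c bnd unfolding rel_def ij ij' ab inner_cells_def by auto
    next
      case 2
      then have "\<not> h a b" "\<not> v a b" "\<not> v (a - 1) b" using off by auto
      then show ?thesis using r c bnd unfolding rel_def ij ij' ab inner_cells_def by auto
    next
      case 3
      then have "\<not> h a b" "\<not> h a (b - 1)" "\<not> v (a - 1) b" using off by auto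
      then show ?thesis using r c bnd unfolding rel_def ij ij' ab inner_cells_def by auto
    next
      case 4
      then have "\<not> h a b" "\<not> h a (b - 1)" "\<not> v a b" using off by auto
      then show ?thesis using r c bnd unfolding rel_def ij ij' ab inner_cells_def by auto
    qed
  qed
qed

text \<open>The rectangle corners themselves, in place of the inner vertices next to them in
  \<open>outlets\<close>. For \<open>n = 2\<close> the four neighbouring vertices are all
  \<open>(1, 1)\<close>, while the corners are always distinct, also between different
  rectangles.\<close>

definition bounces :: "int \<Rightarrow> (int \<times> int) set" where
  "bounces k = {w. w = (0, k) \<and> h 0 (k - 1) \<or> w = (k, 0) \<and> v (k - 1) 0 \<or>
     w = (n, n - k) \<and> h (n - 1) (n - k - 1) \<or> w = (n - k, n) \<and> v (n - k - 1) (n - 1)}"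

lemma finite_bounces: "finite (bounces k)"
  by (rule finite_subset[of _ "{(0, k), (k, 0), (n, n - k), (n - k, n)}"]) (auto simp: bounces_def)

text \<open>The dimers supply at least as many inner covered cells as there are inner vertices
  without the outlets, but there are fewer inner cells than inner vertices. So at least one bounce
  is needed, and every monomer strictly inside the rectangle costs one more.\<close>

lemma card_uncovered_inner:
  assumes "1 \<le> k" "k < n"
  shows "card {c \<in> inner_cells k. uncovered (fst c) (snd c)} < card (bounces k)"
proof -
  \<comment> \<open>Clamping both coordinates to \<open>1..n - 1\<close> pushes a corner of the
    rectangle to the inner vertex beside it.\<close>
  let ?f = "\<lambda>(i, j). (max 1 (min (n - 1) i), max 1 (min (n - 1) j))"
  have "outlets k \<subseteq> ?f ` bounces k"
  proof
    fix w assume "w \<in> outlets k"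
    then consider "w = (1, k)" "h 0 (k - 1)" | "w = (k, 1)" "v (k - 1) 0"
      | "w = (n - 1, n - k)" "h (n - 1) (n - k - 1)" | "w = (n - k, n - 1)" "v (n - k - 1) (n - 1)"
      unfolding outlets_def by blast
    then have "\<exists>u \<in> bounces k. ?f u = w"
    proof cases
      case 1
      then show ?thesis using assms by (intro bexI[of _ "(0, k)"]) (auto simp: bounces_def)
    next
      case 2
      then show ?thesis using assms by (intro bexI[of _ "(k, 0)"]) (auto simp: bounces_def)
    next
      case 3
      then show ?thesis using assms by (intro bexI[of _ "(n, n - k)"]) (auto simp: bounces_def)
    next
      case 4
      then show ?thesis using assms by (intro bexI[of _ "(n - k, n)"]) (auto simp: bounces_def)
    qed
    then show "w \<in> ?f ` bounces k" by blast
  qed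
  then have outlets: "card (outlets k) \<le> card (bounces k)" "finite (outlets k)"
    using surj_card_le[OF finite_bounces] finite_surj[OF finite_bounces] by simp_all
  have "card (inner_vertices k) \<le> card (inner_vertices k - outlets k) + card (outlets k)"
    using diff_card_le_card_Diff[OF outlets(2), of "inner_vertices k"] by linarith
  moreover have "inner_cells k = {c \<in> inner_cells k. \<not> uncovered (fst c) (snd c)}
      \<union> {c \<in> inner_cells k. uncovered (fst c) (snd c)}"
    by blast
  then have "card (inner_cells k) = card {c \<in> inner_cells k. \<not> uncovered (fst c) (snd c)}
      + card {c \<in> inner_cells k. uncovered (fst c) (snd c)}"
    by (subst card_Un_disjoint[symmetric]) (auto simp: finite_inner)
  ultimately show ?thesis
    using card_inner_cells[OF assms] card_inner_le[OF assms] outlets(1) by linarith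
qed

text \<open>Distributes the two points covered by a dimer over its two cells: the left or upper cell
  gets its lower right corner, the other cell its upper left corner. Points on the border of the
  grid occur as well when the dimer lies along it.\<close>

definition diag_vertex :: "int \<times> int \<Rightarrow> int \<times> int" where
  "diag_vertex = (\<lambda>(i, j). if h i (j - 1) \<or> v (i - 1) j then (i, j) else (i + 1, j + 1))"

end

section \<open>Exactly \<open>n\<close> monomers: the count of covered points is tight\<close>

locale max_tatami = tatami +
  assumes card_uncovered: "card {(i, j). uncovered i j} = nat n"
begin

definition covered_cells :: "(int \<times> int) set" where
  "covered_cells = {(i, j). 0 \<le> i \<and> i < n \<and> 0 \<le> j \<and> j < n \<and> \<not> uncovered i j}"

lemma finite_covered_cells: "finite covered_cells"
  by (rule finite_subset[of _ "{0..n} \<times> {0..n}"]) (auto simp: covered_cells_def)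

lemma card_covered_cells: "card covered_cells = nat (n * n - n)"
proof -
  have "covered_cells = {0..<n} \<times> {0..<n} - {(i, j). uncovered i j}"
    by (auto simp: covered_cells_def)
  moreover have "{(i, j). uncovered i j} \<subseteq> {0..<n} \<times> {0..<n}"
    by (auto simp: uncovered_def)
  ultimately show ?thesis
    using card_uncovered n_pos
    by (simp add: card_Diff_subset finite_subset card_cartesian_product nat_mult_distrib nat_diff_distrib)
qed

lemma bounces_subset:
  assumes "1 \<le> k" "k < n"
  shows "bounces k \<subseteq> diag_vertex ` covered_cells"
proof
  fix w assume "w \<in> bounces k"
  then consider "w = (0, k)" "h 0 (k - 1)" | "w = (k, 0)" "v (k - 1) 0"
    | "w = (n, n - k)" "h (n - 1) (n - k - 1)" | "w = (n - k, n)" "v (n - k - 1) (n - 1)"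
    unfolding bounces_def by blast
  then show "w \<in> diag_vertex ` covered_cells"
  proof cases
    case 1
    then show ?thesis using assms n_pos
      by (intro image_eqI[of _ _ "(0, k)"]) (auto simp: diag_vertex_def covered_cells_def uncovered_def)
  next
    case 2
    then show ?thesis using assms n_pos
      by (intro image_eqI[of _ _ "(k, 0)"]) (auto simp: diag_vertex_def covered_cells_def uncovered_def)
  next
    case 3
    then have "\<not> h (n - 1) (n - k - 2)" "\<not> v (n - 2) (n - k - 1)"
      using hh'[of "n - 1" "n - k - 1"] hv[of "n - 1" "n - k - 1"] by (auto simp: algebra_simps)
    then show ?thesis using 3 assms n_pos
      by (intro image_eqI[of _ _ "(n - 1, n - k - 1)"]) (auto simp: diag_vertex_def covered_cells_def uncovered_def)
  next
    case 4
    then have "\<not> v (n - k - 2) (n - 1)" "\<not> h (n - k - 1) (n - 2)"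
      using vv'[of "n - k - 1" "n - 1"] hv'[of "n - k - 1" "n - 1"] by (auto simp: algebra_simps)
    then show ?thesis using 4 assms n_pos
      by (intro image_eqI[of _ _ "(n - k - 1, n - 1)"]) (auto simp: diag_vertex_def covered_cells_def uncovered_def)
  qed
qed

lemma interior_subset: "{1..<n} \<times> {1..<n} \<subseteq> diag_vertex ` covered_cells"
proof clarify
  fix i j assume ij: "i \<in> {1..<n}" "j \<in> {1..<n}"
  then consider "h (i - 1) (j - 1)" | "h i (j - 1)" | "v (i - 1) (j - 1)" | "v (i - 1) j"
    using vertex_covered[of i j] by auto
  then show "(i, j) \<in> diag_vertex ` covered_cells"
  proof cases
    case 1
    then have "\<not> h (i - 1) (j - 1 - 1)" "\<not> v (i - 1 - 1) (j - 1)"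
      using hh'[of "i - 1" "j - 1"] hv[of "i - 1" "j - 1"] by (auto simp: algebra_simps)
    then show ?thesis using 1 ij
      by (intro image_eqI[of _ _ "(i - 1, j - 1)"]) (auto simp: diag_vertex_def covered_cells_def uncovered_def)
  next
    case 3
    then have "\<not> h (i - 1) (j - 1 - 1)" "\<not> v (i - 1 - 1) (j - 1)"
      using vv'[of "i - 1" "j - 1"] hv'[of "i - 1" "j - 1"] by (auto simp: algebra_simps)
    then show ?thesis using 3 ij
      by (intro image_eqI[of _ _ "(i - 1, j - 1)"]) (auto simp: diag_vertex_def covered_cells_def uncovered_def)
  qed (use ij in \<open>intro image_eqI[of _ _ "(i, j)"]; auto simp: diag_vertex_def covered_cells_def uncovered_def\<close>)+
qed

lemma bounces_disjoint:
  assumes "1 \<le> k" "k < n" "1 \<le> l" "l < n" "w \<in> bounces k" "w \<in> bounces l"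
  shows "k = l"
  using assms by (auto simp: bounces_def)

text \<open>The image of \<open>diag_vertex\<close> contains all \<open>(n - 1)^2\<close> interior
  points and a bounce of each of the \<open>n - 1\<close> rectangles, together
  \<open>n^2 - n\<close> points. This is already the number of covered cells, so no two cells share
  a point and no rectangle has a second bounce.\<close>

lemma rigidity:
  shows inj_diag_vertex: "inj_on diag_vertex covered_cells"
    and card_bounces: "1 \<le> k \<Longrightarrow> k < n \<Longrightarrow> card (bounces k) = 1"
proof -
  define b where "b k = (SOME w. w \<in> bounces k)" for k
  have b: "b k \<in> bounces k" if "1 \<le> k" "k < n" for k
  proof -
    have "bounces k \<noteq> {}" using card_uncovered_inner[OF that] by auto
    then show ?thesis unfolding b_def by (simp add: some_in_eq)
  qed
  let ?A = "{1..<n} \<times> {1..<n} \<union> b ` {1..<n}"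
  have inj: "inj_on b {1..<n}"
  proof (rule inj_onI)
    fix k l assume "k \<in> {1..<n}" "l \<in> {1..<n}" "b k = b l"
    moreover from this have "b k \<in> bounces k" "b k \<in> bounces l"
      using b[of k] b[of l] by simp_all
    ultimately show "k = l" using bounces_disjoint[of k l "b k"] by simp
  qed
  have disj: "bounces k \<inter> {1..<n} \<times> {1..<n} = {}" for k
    by (auto simp: bounces_def)
  have "b k \<notin> {1..<n} \<times> {1..<n}" if "k \<in> {1..<n}" for k
  proof
    assume "b k \<in> {1..<n} \<times> {1..<n}"
    then have "b k \<in> bounces k \<inter> {1..<n} \<times> {1..<n}" using b[of k] that by simp
    then show False by (simp only: disj empty_iff)
  qed
  then have "{1..<n} \<times> {1..<n} \<inter> b ` {1..<n} = {}"
    unfolding disjoint_iff by (metis imageE)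
  then have "card ?A = card ({1..<n} \<times> {1..<n}) + card (b ` {1..<n})"
    by (intro card_Un_disjoint) simp_all
  also have "\<dots> = nat (n - 1) * nat (n - 1) + nat (n - 1)"
    by (simp add: card_image[OF inj] card_cartesian_product)
  also have "\<dots> = nat (n * n - n)"
  proof -
    obtain m where "n = int m + 1" using n_pos by (metis add.commute zle_iff_zadd)
    then show ?thesis by (simp add: algebra_simps nat_add_distrib nat_mult_distrib)
  qed
  finally have card: "card ?A = card covered_cells" by (simp add: card_covered_cells)
  have "b k \<in> diag_vertex ` covered_cells" if "k \<in> {1..<n}" for k
    using subsetD[OF bounces_subset[of k] b[of k]] that by simp
  then have sub: "?A \<subseteq> diag_vertex ` covered_cells"
    using interior_subset by blast
  then have eq: "?A = diag_vertex ` covered_cells"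
    using card_image_le[OF finite_covered_cells, of diag_vertex] card finite_covered_cells
    by (intro card_seteq) simp_all
  then show "inj_on diag_vertex covered_cells"
    using card finite_covered_cells by (intro eq_card_imp_inj_on) simp_all
  show "card (bounces k) = 1" if k: "1 \<le> k" "k < n"
  proof -
    have "bounces k \<subseteq> {b k}"
    proof
      fix w assume w: "w \<in> bounces k"
      then have "w \<in> b ` {1..<n}"
        using bounces_subset[OF k] eq disj[of k] by blast
      then obtain l where "1 \<le> l" "l < n" "w = b l" by auto
      then show "w \<in> {b k}" using bounces_disjoint[OF k _ _ w] b by auto
    qed
    then have "bounces k = {b k}" using b[OF k] by auto
    then show ?thesis by simp
  qed
qed

lemma interior_not_uncovered:
  assumes "0 < i" "i < n - 1" "0 < j" "j < n - 1"
  shows "\<not> uncovered i j"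
proof
  assume u: "uncovered i j"
  \<comment> \<open>The smallest \<open>k\<close> whose rectangle is wide enough for the diagonal of
    the cell. A monomer in it would force two bounces.\<close>
  let ?k = "\<bar>i - j\<bar> + 1"
  have k: "1 \<le> ?k" "?k < n" using assms by auto
  have "(i, j) \<in> {c \<in> inner_cells ?k. uncovered (fst c) (snd c)}"
    using u assms by (auto simp: inner_cells_def)
  then have "card {c \<in> inner_cells ?k. uncovered (fst c) (snd c)} \<noteq> 0"
    using finite_inner by auto
  then show False using card_uncovered_inner[OF k] card_bounces[OF k] by simp
qed

end

subsection \<open>Signs of the diagonals and the word of a tiling\<close>

text \<open>
  The sign \<open>X\<close> (defined below) on the diagonal \<open>i - j = s\<close> and the sign \<open>Y\<close> on the antidiagonal
  \<open>i + j = t\<close> in terms of the two bits recording the covered corner of each rectangle.  The values \<open>q 0\<close>, \<open>r 0\<close>, \<open>q n\<close>, \<open>r n\<close> are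
  dummies, set to \<open>False\<close>; this matches the choice made for corner monomers.
\<close>

definition diag_sign :: "(int \<Rightarrow> bool) \<Rightarrow> (int \<Rightarrow> bool) \<Rightarrow> int \<Rightarrow> bool" where
  "diag_sign q r s = (if s \<le> 0 then (if r (- s) then q (- s) else \<not> q (1 - s))
     else (if r s then \<not> q (s + 1) else q s))"

definition anti_sign :: "int \<Rightarrow> (int \<Rightarrow> bool) \<Rightarrow> (int \<Rightarrow> bool) \<Rightarrow> int \<Rightarrow> bool" where
  "anti_sign n q r t = (if t < n then (if q (t + 1) then r (t + 1) else \<not> r t)
     else (if q (2 * n - 1 - t) then \<not> r (2 * n - 2 - t) else r (2 * n - 1 - t)))"

definition word :: "int \<Rightarrow> (int \<Rightarrow> bool) \<Rightarrow> (int \<Rightarrow> bool) \<Rightarrow> bool" where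
  "word n q r \<longleftrightarrow> (\<forall>k. q k \<or> r k \<longrightarrow> 1 \<le> k \<and> k < n) \<and>
     \<not> (\<exists>k l. 1 \<le> k \<and> k \<le> l \<and> l \<le> n - 2 \<and> q k = q (k + 1) \<and> r l = r (l + 1))"

lemma alternating_parity:
  fixes f :: "int \<Rightarrow> bool"
  assumes "b \<le> c" "\<And>a. b \<le> a \<Longrightarrow> a < c \<Longrightarrow> f a \<noteq> f (a + 1)"
  shows "f c \<longleftrightarrow> (f b \<longleftrightarrow> even (c - b))"
  using assms
proof (induction c rule: int_ge_induct)
  case (step c)
  then have "f c \<longleftrightarrow> (f b \<longleftrightarrow> even (c - b))" "f c \<noteq> f (c + 1)" by auto
  then show ?case by auto
qed simp

context tatami begin

lemma cell_cases:
  assumes "0 \<le> i" "i < n" "0 \<le> j" "j < n"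
  shows "h i j \<and> \<not> h i (j - 1) \<and> \<not> v i j \<and> \<not> v (i - 1) j \<and> \<not> uncovered i j \<or>
    \<not> h i j \<and> h i (j - 1) \<and> \<not> v i j \<and> \<not> v (i - 1) j \<and> \<not> uncovered i j \<or>
    \<not> h i j \<and> \<not> h i (j - 1) \<and> v i j \<and> \<not> v (i - 1) j \<and> \<not> uncovered i j \<or>
    \<not> h i j \<and> \<not> h i (j - 1) \<and> \<not> v i j \<and> v (i - 1) j \<and> \<not> uncovered i j \<or>
    \<not> h i j \<and> \<not> h i (j - 1) \<and> \<not> v i j \<and> \<not> v (i - 1) j \<and> uncovered i j"
proof -
  have "\<not> (h i (j - 1) \<and> v i j)" "\<not> (h i (j - 1) \<and> v (i - 1) j)"
    using hv[of i "j - 1"] by auto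
  moreover have "\<not> (h i j \<and> h i (j - 1))" "\<not> (h i j \<and> v i j)" "\<not> (h i j \<and> v (i - 1) j)"
      "\<not> (v i j \<and> v (i - 1) j)"
    using hh'[of i j] hv[of i j] vv'[of i j] by auto
  moreover have "uncovered i j \<longleftrightarrow> \<not> h i j \<and> \<not> h i (j - 1) \<and> \<not> v i j \<and> \<not> v (i - 1) j"
    using assms by (auto simp: uncovered_def)
  ultimately show ?thesis by argo
qed

end

context max_tatami begin

text \<open>
  The sign \<open>X\<close> tells whether a cell points up-left (up or left) rather than down-right, and \<open>Y\<close>
  whether it points up-right rather than down-left.  A monomer points out of the grid; of the two
  choices at a corner, \<open>X\<close> and \<open>Y\<close> fix left at \<open>(n - 1, 0)\<close>, right at \<open>(n - 1, n - 1)\<close> and up at the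
  other two.
\<close>

definition X :: "int \<Rightarrow> int \<Rightarrow> bool" where
  "X i j \<longleftrightarrow> h i (j - 1) \<or> v (i - 1) j \<or> uncovered i j \<and> (i = 0 \<or> j = 0)"

definition Y :: "int \<Rightarrow> int \<Rightarrow> bool" where
  "Y i j \<longleftrightarrow> h i j \<or> v (i - 1) j \<or> uncovered i j \<and> (i = 0 \<or> j = n - 1)"

lemma uncovered_boundary:
  assumes "uncovered i j"
  shows "i = 0 \<or> i = n - 1 \<or> j = 0 \<or> j = n - 1"
proof (rule ccontr)
  assume "\<not> ?thesis"
  then have "0 < i" "i < n - 1" "0 < j" "j < n - 1" using assms unfolding uncovered_def by linarith+
  then show False using assms interior_not_uncovered by blast
qed

text \<open>The point \<open>(i, j)\<close> would be the \<open>diag_vertex\<close> of both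
  \<open>(i - 1, j - 1)\<close> and \<open>(i, j)\<close>. In other words, no interior point is
  covered twice.\<close>

lemma diag_vertex_unique:
  assumes "h (i - 1) (j - 1) \<or> v (i - 1) (j - 1)" "h i (j - 1) \<or> v (i - 1) j"
  shows False
proof -
  have "(i - 1, j - 1) \<in> covered_cells" "(i, j) \<in> covered_cells"
    using assms h_in[of "i - 1" "j - 1"] v_in[of "i - 1" "j - 1"] h_in[of i "j - 1"] v_in[of "i - 1" j]
    by (auto simp: covered_cells_def uncovered_def)
  moreover have "diag_vertex (i - 1, j - 1) = diag_vertex (i, j)"
    using assms hh'[of "i - 1" "j - 1"] hv[of "i - 1" "j - 1"] vv'[of "i - 1" "j - 1"] hv'[of "i - 1" "j - 1"]
    by (auto simp: diag_vertex_def)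
  ultimately show False using inj_diag_vertex unfolding inj_on_def by fastforce
qed

text \<open>The dimer covering the point \<open>(i, j)\<close> contains either
  \<open>(i, j)\<close>, which then points up-left, or \<open>(i - 1, j - 1)\<close>, which then
  points down-right, and never both kinds occur. If one of the two cells is a monomer, it lies on
  the border, and its outward direction agrees with this rule.\<close>

lemma X_step:
  assumes "0 < i" "i < n" "0 < j" "j < n"
  shows "X i j = X (i - 1) (j - 1)"
proof -
  have "X i j \<longleftrightarrow> h i (j - 1) \<or> v (i - 1) j" using assms by (auto simp: X_def)
  moreover have "\<dots> \<longleftrightarrow> \<not> (h (i - 1) (j - 1) \<or> v (i - 1) (j - 1))"
    using vertex_covered[OF assms] diag_vertex_unique[of i j] by blast
  moreover have "\<dots> \<longleftrightarrow> X (i - 1) (j - 1)"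
    using assms uncovered_boundary[of "i - 1" "j - 1"] cell_cases[of "i - 1" "j - 1"]
    by (auto simp: X_def)
  ultimately show ?thesis by simp
qed

text \<open>The covering dimer of \<open>(i, j)\<close> also contains exactly one of the two cells
  meeting there along the antidiagonal, so the argument for \<open>X\<close> carries over.\<close>

lemma Y_step:
  assumes "0 < i" "i < n" "0 < j" "j < n"
  shows "Y i (j - 1) = Y (i - 1) j"
proof -
  have "Y i (j - 1) \<longleftrightarrow> h i (j - 1) \<or> v (i - 1) (j - 1)" using assms by (auto simp: Y_def)
  moreover have "\<dots> \<longleftrightarrow> \<not> (h (i - 1) (j - 1) \<or> v (i - 1) j)"
    using vertex_covered[OF assms] diag_vertex_unique[of i j]
      hv[of "i - 1" "j - 1"] hv[of i "j - 1"] by auto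
  moreover have "\<dots> \<longleftrightarrow> Y (i - 1) j"
    using assms uncovered_boundary[of "i - 1" "j"] cell_cases[of "i - 1" "j"]
    by (auto simp: Y_def)
  ultimately show ?thesis by simp
qed

definition x :: "int \<Rightarrow> bool" where
  "x s = X (max s 0) (max (- s) 0)"

definition y :: "int \<Rightarrow> bool" where
  "y t = (if t < n then Y t 0 else Y (n - 1) (t - n + 1))"

lemma X_eq:
  assumes "0 \<le> i" "i < n" "0 \<le> j" "j < n"
  shows "X i j = x (i - j)"
proof -
  have "X (a + int k) (b + int k) = X a b" if "0 \<le> a" "0 \<le> b" "a + int k < n" "b + int k < n" for a b k
    using that by (induction k) (use X_step[of "a + int (Suc k)" "b + int (Suc k)" for k] in auto)
  from this[where a = "i - j" and b = 0 and k = "nat j"] this[where a = 0 and b = "j - i" and k = "nat i"] show ?thesis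
    using assms by (cases "i \<ge> j") (auto simp: x_def max_def)
qed

lemma Y_eq:
  assumes "0 \<le> i" "i < n" "0 \<le> j" "j < n"
  shows "Y i j = y (i + j)"
proof -
  have "Y (a - int k) (b + int k) = Y a b" if "0 \<le> b" "a < n" "0 \<le> a - int k" "b + int k < n" for a b k
    using that by (induction k) (use Y_step[of "a - int k" "b + int (Suc k)" for k] in \<open>auto simp: algebra_simps\<close>)
  from this[where a = "i + j" and b = 0 and k = "nat j"]
    this[where a = "n - 1" and b = "i + j - n + 1" and k = "nat (n - 1 - i)"] show ?thesis
    using assms by (cases "i + j < n") (auto simp: y_def)
qed

text \<open>The two signs of a cell encode its arrow: up is \<open>x\<close> and \<open>y\<close>,
  left is \<open>x\<close> and not \<open>y\<close>, right is \<open>y\<close> and not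
  \<open>x\<close>, down is neither. The bound on \<open>j\<close> keeps a right arrow inside the
  grid, so it cannot come from a monomer.\<close>

lemma h_iff: "0 \<le> i \<Longrightarrow> i < n \<Longrightarrow> 0 \<le> j \<Longrightarrow> j + 1 < n \<Longrightarrow> h i j \<longleftrightarrow> \<not> x (i - j) \<and> y (i + j)"
  using uncovered_boundary[of i j] cell_cases[of i j]
    by (auto simp: X_eq[symmetric] Y_eq[symmetric] X_def Y_def)

lemma h_iff': "0 \<le> i \<Longrightarrow> i < n \<Longrightarrow> 0 < j \<Longrightarrow> j < n \<Longrightarrow> h i (j - 1) \<longleftrightarrow> x (i - j) \<and> \<not> y (i + j)"
  using uncovered_boundary[of i j] cell_cases[of i j]
    by (auto simp: X_eq[symmetric] Y_eq[symmetric] X_def Y_def)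

lemma v_iff: "0 \<le> i \<Longrightarrow> i + 1 < n \<Longrightarrow> 0 \<le> j \<Longrightarrow> j < n \<Longrightarrow> v i j \<longleftrightarrow> \<not> x (i - j) \<and> \<not> y (i + j)"
  using uncovered_boundary[of i j] cell_cases[of i j]
    by (auto simp: X_eq[symmetric] Y_eq[symmetric] X_def Y_def)

lemma v_iff': "0 < i \<Longrightarrow> i < n \<Longrightarrow> 0 \<le> j \<Longrightarrow> j < n \<Longrightarrow> v (i - 1) j \<longleftrightarrow> x (i - j) \<and> y (i + j)"
  using uncovered_boundary[of i j] cell_cases[of i j]
    by (auto simp: X_eq[symmetric] Y_eq[symmetric] X_def Y_def)

text \<open>At a corner of the grid one value of a sign leaves only directions out of the grid. The
  cell is then a monomer, and the convention for corner monomers fixes the other sign. These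
  implications settle the signs that the bounces alone leave open.\<close>

lemma corner_signs:
  "x 0 \<Longrightarrow> y 0" "\<not> x 0 \<Longrightarrow> y (2 * n - 2)" "\<not> y (n - 1) \<Longrightarrow> x (n - 1)" "y (n - 1) \<Longrightarrow> x (1 - n)"
proof -
  show "x 0 \<Longrightarrow> y 0"
    using X_eq[of 0 0] Y_eq[of 0 0] n_pos h_in[of 0 "-1"] v_in[of "-1" 0] by (auto simp: X_def Y_def)
  show "\<not> x 0 \<Longrightarrow> y (2 * n - 2)"
    using X_eq[of "n - 1" "n - 1"] Y_eq[of "n - 1" "n - 1"] n_pos h_in[of "n - 1" "n - 1"] v_in[of "n - 1" "n - 1"]
    by (auto simp: X_def Y_def uncovered_def)
  show "\<not> y (n - 1) \<Longrightarrow> x (n - 1)"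
    using X_eq[of "n - 1" 0] Y_eq[of "n - 1" 0] n_pos h_in[of "n - 1" "- 1"] v_in[of "n - 1" 0]
    by (auto simp: X_def Y_def uncovered_def)
  show "y (n - 1) \<Longrightarrow> x (1 - n)"
    using X_eq[of 0 "n - 1"] Y_eq[of 0 "n - 1"] n_pos h_in[of 0 "n - 1"] v_in[of "-1" "n - 1"]
    by (auto simp: X_def Y_def uncovered_def)
qed

end

lemma ex_equal_neighbours:
  fixes f :: "int \<Rightarrow> bool"
  assumes "f b \<noteq> f c" "b \<le> c" "even (c - b)"
  shows "\<exists>a\<ge>b. a < c \<and> f a = f (a + 1)"
proof (rule ccontr)
  assume "\<not> ?thesis"
  then have "f a \<noteq> f (a + 1)" if "b \<le> a" "a < c" for a using that by blast
  then have "f c \<longleftrightarrow> (f b \<longleftrightarrow> even (c - b))" by (intro alternating_parity[where f = f] assms(2)) auto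
  then show False using assms(1,3) by blast
qed

section \<open>Recovering all signs from the bounces\<close>

context max_tatami begin

text \<open>The same possible dimer read from both ends: \<open>(i, j)\<close> points right exactly
  if \<open>(i, j + 1)\<close> points left.\<close>

lemma x_y_horizontal:
  assumes "0 \<le> i" "i < n" "0 \<le> j" "j + 1 < n"
  shows "\<not> x (i - j) \<and> y (i + j) \<longleftrightarrow> x (i - j - 1) \<and> \<not> y (i + j + 1)"
  using h_iff[of i j] h_iff'[of i "j + 1"] assms by (auto simp: algebra_simps)

lemma x_y_vertical:
  assumes "0 \<le> i" "i + 1 < n" "0 \<le> j" "j < n"
  shows "\<not> x (i - j) \<and> \<not> y (i + j) \<longleftrightarrow> x (i - j + 1) \<and> y (i + j + 1)"
  using v_iff[of i j] v_iff'[of "i + 1" j] assms by (auto simp: algebra_simps)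

definition top_bounce where "top_bounce k \<longleftrightarrow> h 0 (k - 1)"
definition left_bounce where "left_bounce k \<longleftrightarrow> v (k - 1) 0"
definition bottom_bounce where "bottom_bounce k \<longleftrightarrow> h (n - 1) (n - k - 1)"
definition right_bounce where "right_bounce k \<longleftrightarrow> v (n - k - 1) (n - 1)"

text \<open>Each corner dimer is read from either of its cells. The odd-numbered facts for
  \<open>k + 1\<close> and the even-numbered facts for \<open>k\<close> speak about the same four
  signs: those of the diagonals \<open>k\<close>, \<open>- k\<close> and of the antidiagonals
  \<open>k\<close>, \<open>2 * n - 2 - k\<close>.\<close>

lemma bounce_signs:
  assumes "1 \<le> k" "k < n"
  shows "top_bounce k \<longleftrightarrow> \<not> x (1 - k) \<and> y (k - 1)" "top_bounce k \<longleftrightarrow> x (- k) \<and> \<not> y k"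
    "left_bounce k \<longleftrightarrow> \<not> x (k - 1) \<and> \<not> y (k - 1)" "left_bounce k \<longleftrightarrow> x k \<and> y k"
    "bottom_bounce k \<longleftrightarrow> x (k - 1) \<and> \<not> y (2 * n - 1 - k)" "bottom_bounce k \<longleftrightarrow> \<not> x k \<and> y (2 * n - 2 - k)"
    "right_bounce k \<longleftrightarrow> x (1 - k) \<and> y (2 * n - 1 - k)" "right_bounce k \<longleftrightarrow> \<not> x (- k) \<and> \<not> y (2 * n - 2 - k)"
  unfolding top_bounce_def left_bounce_def bottom_bounce_def right_bounce_def
  using assms h_iff[of 0 "k - 1"] h_iff'[of 0 k] v_iff[of "k - 1" 0] v_iff'[of k 0]
    h_iff[of "n - 1" "n - k - 1"] h_iff'[of "n - 1" "n - k"] v_iff[of "n - k - 1" "n - 1"] v_iff'[of "n - k" "n - 1"]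
  by (auto simp: algebra_simps)

lemma one_bounce:
  assumes "1 \<le> k" "k < n"
  shows "top_bounce k \<and> \<not> left_bounce k \<and> \<not> bottom_bounce k \<and> \<not> right_bounce k \<or> \<not> top_bounce k \<and> left_bounce k \<and> \<not> bottom_bounce k \<and> \<not> right_bounce k \<or>
    \<not> top_bounce k \<and> \<not> left_bounce k \<and> bottom_bounce k \<and> \<not> right_bounce k \<or> \<not> top_bounce k \<and> \<not> left_bounce k \<and> \<not> bottom_bounce k \<and> right_bounce k"
proof -
  obtain a b where w: "bounces k = {(a, b)}"
    using card_bounces[OF assms] by (metis card_1_singletonE surj_pair)
  have "(a, b) \<in> bounces k" using w by simp
  then have "top_bounce k \<or> left_bounce k \<or> bottom_bounce k \<or> right_bounce k"
    by (auto simp: bounces_def top_bounce_def left_bounce_def bottom_bounce_def right_bounce_def)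
  moreover have "top_bounce k \<Longrightarrow> (0, k) \<in> bounces k" "left_bounce k \<Longrightarrow> (k, 0) \<in> bounces k"
      "bottom_bounce k \<Longrightarrow> (n, n - k) \<in> bounces k" "right_bounce k \<Longrightarrow> (n - k, n) \<in> bounces k"
    by (auto simp: bounces_def top_bounce_def left_bounce_def bottom_bounce_def right_bounce_def)
  then have "top_bounce k \<Longrightarrow> a = 0 \<and> b = k" "left_bounce k \<Longrightarrow> a = k \<and> b = 0"
      "bottom_bounce k \<Longrightarrow> a = n \<and> b = n - k" "right_bounce k \<Longrightarrow> a = n - k \<and> b = n"
    unfolding w by simp_all
  ultimately show ?thesis using assms by smt
qed

text \<open>The bits locate the bounce: \<open>q k\<close> says that it lies on the side
  \<open>i + j = k\<close> of the rectangle, \<open>r k\<close> that it lies on the side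
  \<open>j - i = k\<close>.\<close>

definition q where "q k \<longleftrightarrow> 1 \<le> k \<and> k < n \<and> (top_bounce k \<or> left_bounce k)"
definition r where "r k \<longleftrightarrow> 1 \<le> k \<and> k < n \<and> (top_bounce k \<or> right_bounce k)"

lemma bounce_qr:
  assumes "1 \<le> k" "k < n"
  shows "top_bounce k \<longleftrightarrow> q k \<and> r k" "left_bounce k \<longleftrightarrow> q k \<and> \<not> r k" "bottom_bounce k \<longleftrightarrow> \<not> q k \<and> \<not> r k" "right_bounce k \<longleftrightarrow> \<not> q k \<and> r k"
  unfolding q_def r_def using one_bounce[OF assms] assms by blast+

text \<open>The bounces of the rectangles \<open>k\<close> and \<open>k + 1\<close> constrain the
  same four signs, and together they determine them.\<close>

lemma signs_middle:
  assumes "1 \<le> k" "k < n - 1"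
  shows "x k = (if r k then \<not> q (k + 1) else q k)" "x (- k) = (if r k then q k else \<not> q (k + 1))"
    "y k = (if q (k + 1) then r (k + 1) else \<not> r k)" "y (2 * n - 2 - k) = (if q (k + 1) then \<not> r k else r (k + 1))"
proof -
  have k: "1 \<le> k" "k < n" "1 \<le> k + 1" "k + 1 < n" using assms by auto
  have e: "1 - (k + 1) = - k" "k + 1 - 1 = k" "2 * n - 1 - (k + 1) = 2 * n - 2 - k" by auto
  note a = bounce_signs(2,4,6,8)[OF k(1,2)] bounce_signs(1,3,5,7)[OF k(3,4), unfolded e]
    bounce_qr[OF k(1,2)] bounce_qr[OF k(3,4)]
  show "x k = (if r k then \<not> q (k + 1) else q k)" "x (- k) = (if r k then q k else \<not> q (k + 1))"
    "y k = (if q (k + 1) then r (k + 1) else \<not> r k)" "y (2 * n - 2 - k) = (if q (k + 1) then \<not> r k else r (k + 1))"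
    using a by argo+
qed

text \<open>Only rectangle \<open>1\<close> constrains these signs; where its bounce does not
  decide, the corner convention does. The result fits the general formula with \<open>q 0\<close>
  and \<open>r 0\<close> read as \<open>False\<close>.\<close>

lemma signs_first:
  assumes "1 < n"
  shows "x 0 = (\<not> q 1)" "y 0 = (if q 1 then r 1 else True)" "y (2 * n - 2) = (if q 1 then True else r 1)"
proof -
  have k: "1 \<le> (1 :: int)" "1 < n" and e: "1 - 1 = (0 :: int)" "2 * n - 1 - 1 = 2 * n - 2" using assms by auto
  note a = bounce_signs(1,3,5,7)[OF k, unfolded e] bounce_qr[OF k]
  have c: "x 0 \<longrightarrow> y 0" "\<not> x 0 \<longrightarrow> y (2 * n - 2)" using corner_signs by auto
  show "x 0 = (\<not> q 1)" "y 0 = (if q 1 then r 1 else True)" "y (2 * n - 2) = (if q 1 then True else r 1)"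
    using a c by argo+
qed

lemma signs_last:
  assumes "1 < n"
  shows "y (n - 1) = (\<not> r (n - 1))" "x (n - 1) = (if r (n - 1) then True else q (n - 1))"
    "x (1 - n) = (if r (n - 1) then q (n - 1) else True)"
proof -
  have k: "1 \<le> n - 1" "n - 1 < n" and e: "2 * n - 2 - (n - 1) = n - 1" "- (n - 1) = 1 - n" using assms by auto
  note a = bounce_signs(2,4,6,8)[OF k, unfolded e] bounce_qr[OF k]
  have c: "\<not> y (n - 1) \<longrightarrow> x (n - 1)" "y (n - 1) \<longrightarrow> x (1 - n)" using corner_signs by auto
  show "y (n - 1) = (\<not> r (n - 1))" "x (n - 1) = (if r (n - 1) then True else q (n - 1))"
    "x (1 - n) = (if r (n - 1) then q (n - 1) else True)"
    using a c by argo+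
qed

lemma qr_outside: "\<not> q 0" "\<not> r 0" "\<not> q n" "\<not> r n"
  by (auto simp: q_def r_def)

lemma x_eq_diag_sign:
  assumes "- n < s" "s < n"
  shows "x s = diag_sign q r s"
proof -
  consider "s = 0" "n = 1" | "s = 0" "1 < n" | "s = n - 1" "0 < s" | "s = 1 - n" "s < 0" | "1 \<le> s" "s < n - 1" | "1 \<le> - s" "- s < n - 1"
    using assms by linarith
  then show ?thesis
  proof cases
    case 1
    then have e: "n - 1 = 0" "1 - n = 0" by simp_all
    have "\<not> q 1" using 1(2) unfolding q_def by linarith
    moreover have "x 0" using corner_signs(3,4) unfolding e by (cases "y 0") simp_all
    moreover note qr_outside(2)
    ultimately show ?thesis using 1(1) by (simp add: diag_sign_def)
  next
    case 5
    then show ?thesis using signs_middle(1)[OF 5] by (simp add: diag_sign_def)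
  next
    case 6
    then show ?thesis using signs_middle(2)[OF 6] by (simp add: diag_sign_def)
  next
    case 2
    then show ?thesis using signs_first qr_outside by (simp add: diag_sign_def)
  next
    case 3
    then have "1 < n" by simp
    with 3 show ?thesis using signs_last qr_outside by (simp add: diag_sign_def)
  next
    case 4
    then have "1 < n" by simp
    with 4 show ?thesis using signs_last qr_outside by (simp add: diag_sign_def)
  qed
qed

lemma y_eq_anti_sign:
  assumes "0 \<le> t" "t \<le> 2 * n - 2"
  shows "y t = anti_sign n q r t"
proof -
  consider "t = 0" "n = 1" | "t = 0" "1 < n" | "t = 2 * n - 2" "1 < n" | "t = n - 1" "1 < n" | "1 \<le> t" "t < n - 1"
    | "1 \<le> 2 * n - 2 - t" "2 * n - 2 - t < n - 1"
    using assms by linarith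
  then show ?thesis
  proof cases
    case 1
    then have e: "2 * n - 2 = 0" by simp
    have "\<not> q 1" using 1(2) unfolding q_def by linarith
    moreover have "y 0" using corner_signs(1,2) unfolding e by (cases "x 0") simp_all
    moreover note qr_outside(2)
    ultimately show ?thesis using 1 by (simp add: anti_sign_def)
  next
    case 5
    then show ?thesis using signs_middle(3)[OF 5] by (simp add: anti_sign_def)
  next
    case 6
    have e: "2 * n - 2 - (2 * n - 2 - t) = t" "2 * n - 2 - t + 1 = 2 * n - 1 - t" by simp_all
    show ?thesis using signs_middle(4)[OF 6, unfolded e] 6 by (simp add: anti_sign_def)
  next
    case 2
    then show ?thesis using signs_first qr_outside by (simp add: anti_sign_def)
  next
    case 3
    then show ?thesis using signs_first qr_outside by (simp add: anti_sign_def)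
  next
    case 4
    then show ?thesis using signs_last qr_outside by (simp add: anti_sign_def)
  qed
qed

text \<open>
  Equal signs on two neighbouring diagonals force the signs of the antidiagonals crossing both to
  alternate.
\<close>

lemma no_crossing:
  assumes "x a = x (a + 1)" "y t = y (t + 1)" "a + 1 \<le> k" "- k \<le> a" "k \<le> t" "t + 1 \<le> 2 * n - 2 - k"
  shows False
proof (cases "even (a + t)")
  case True
  then obtain i where "a + t = 2 * i" by blast
  then have t: "t = 2 * i - a" by linarith
  \<comment> \<open>The cells \<open>(i, j)\<close> and \<open>(i + 1, j)\<close> lie on the
    crossing of the two pairs. As a possible vertical dimer they exclude that the two repeated signs
    are equal, and two adjacent horizontal pairs exclude that they differ.\<close>
  define j where "j = i - a"
  have at: "a = i - j" "t = i + j" unfolding t j_def by simp_all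
  have "0 \<le> i" "i + 1 < n" "1 \<le> j" "j + 1 < n" using assms(3-6) unfolding at by linarith+
  note b = this
  have e: "i + 1 - j = i - j + 1" "i - j + 1 - 1 = i - j" "i + 1 + j = i + j + 1" "i - (j - 1) = i - j + 1"
    "i + (j - 1) + 1 = i + j" by simp_all
  have "\<not> x (i - j) \<and> \<not> y (i + j) \<longleftrightarrow> x (i - j + 1) \<and> y (i + j + 1)"
    by (rule x_y_vertical) (use b in simp_all)
  moreover have "\<not> x (i - j + 1) \<and> y (i + j + 1) \<longleftrightarrow> x (i - j) \<and> \<not> y (i + j + 1 + 1)"
    by (rule x_y_horizontal[of "i + 1" j, unfolded e]) (use b in simp_all)
  moreover have "\<not> x (i - j + 1) \<and> y (i + (j - 1)) \<longleftrightarrow> x (i - j) \<and> \<not> y (i + j)"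
    by (rule x_y_horizontal[of i "j - 1", unfolded e]) (use b in simp_all)
  ultimately show False using assms(1,2)[unfolded at] by argo
next
  case False
  then have "even (a + t + 1)" by simp
  then obtain i where "a + t + 1 = 2 * i" by blast
  then have t: "t = 2 * i - a - 1" by linarith
  \<comment> \<open>In this parity the crossing is the horizontal pair \<open>(i, j)\<close>,
    \<open>(i, j + 1)\<close>: it excludes different repeated signs, and the two vertical pairs
    exclude equal ones.\<close>
  define j where "j = i - a - 1"
  have at: "a = i - j - 1" "t = i + j" unfolding t j_def by simp_all
  have "1 \<le> i" "i + 1 < n" "0 \<le> j" "j + 1 < n" using assms(3-6) unfolding at by linarith+
  note b = this
  have e: "i - j - 1 + 1 = i - j" "i - (j + 1) = i - j - 1" "i + (j + 1) = i + j + 1" "i - 1 - j = i - j - 1"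
    "i - 1 + j + 1 = i + j" by simp_all
  have "\<not> x (i - j) \<and> y (i + j) \<longleftrightarrow> x (i - j - 1) \<and> \<not> y (i + j + 1)"
    by (rule x_y_horizontal) (use b in simp_all)
  moreover have "\<not> x (i - j - 1) \<and> \<not> y (i + j + 1) \<longleftrightarrow> x (i - j) \<and> y (i + j + 1 + 1)"
    by (rule x_y_vertical[of i "j + 1", unfolded e]) (use b in simp_all)
  moreover have "\<not> x (i - j - 1) \<and> \<not> y (i - 1 + j) \<longleftrightarrow> x (i - j) \<and> y (i + j)"
    by (rule x_y_vertical[of "i - 1" j, unfolded e]) (use b in simp_all)
  ultimately show False using assms(1,2)[unfolded at e] by argo
qed

text \<open>A repetition of \<open>q\<close> at \<open>k\<close> makes \<open>x (- k)\<close> and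
  \<open>x k\<close> opposite, so \<open>x\<close> repeats somewhere between; a repetition of
  \<open>r\<close> at \<open>l\<close> does the same for \<open>y\<close> between \<open>l\<close>
  and \<open>2 * n - 2 - l\<close>. The inequality \<open>k \<le> l\<close> places the crossing
  where \<open>no_crossing\<close> applies.\<close>

lemma word_qr: "word n q r"
proof -
  have False if kl: "1 \<le> k" "k \<le> l" "l \<le> n - 2" "q k = q (k + 1)" "r l = r (l + 1)" for k l
  proof -
    have "k < n - 1" "1 \<le> l" "l < n - 1" using kl by linarith+
    note middle = signs_middle(1,2)[OF kl(1) this(1)] signs_middle(3,4)[OF this(2,3)]
    have "x (- k) \<noteq> x k" using middle(1,2) kl(4) by argo
    then have "\<exists>a\<ge>- k. a < k \<and> x a = x (a + 1)"
      by (rule ex_equal_neighbours) (use kl(1) in simp_all)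
    then obtain a where a: "- k \<le> a" "a < k" "x a = x (a + 1)" by blast
    have "y l \<noteq> y (2 * n - 2 - l)" using middle(3,4) kl(5) by argo
    then have "\<exists>t\<ge>l. t < 2 * n - 2 - l \<and> y t = y (t + 1)"
      by (rule ex_equal_neighbours) (use kl(3) in simp_all)
    then obtain t where t: "l \<le> t" "t < 2 * n - 2 - l" "y t = y (t + 1)" by blast
    have "a + 1 \<le> k" "k \<le> t" "t + 1 \<le> 2 * n - 2 - k" using a(2) t(1,2) kl(2) by linarith+
    then show False using no_crossing[OF a(3) t(3) _ a(1)] by blast
  qed
  moreover have "1 \<le> k \<and> k < n" if "q k \<or> r k" for k using that by (auto simp: q_def r_def)
  ultimately show ?thesis unfolding word_def by blast
qed

lemma h_signs: "h i j \<longleftrightarrow> 0 \<le> i \<and> i < n \<and> 0 \<le> j \<and> j + 1 < n \<and> \<not> diag_sign q r (i - j) \<and> anti_sign n q r (i + j)"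
  using h_iff[of i j] h_in[of i j] x_eq_diag_sign[of "i - j"] y_eq_anti_sign[of "i + j"] by auto

lemma v_signs: "v i j \<longleftrightarrow> 0 \<le> i \<and> i + 1 < n \<and> 0 \<le> j \<and> j < n \<and> \<not> diag_sign q r (i - j) \<and> \<not> anti_sign n q r (i + j)"
  using v_iff[of i j] v_in[of i j] x_eq_diag_sign[of "i - j"] y_eq_anti_sign[of "i + j"] by auto

end

subsection \<open>The tiling of a word\<close>

lemma diag_sign_minus: "0 \<le> k \<Longrightarrow> diag_sign q r (- k) = (if r k then q k else \<not> q (k + 1))"
  by (simp add: diag_sign_def add.commute)

lemma diag_sign_plus: "0 < k \<Longrightarrow> diag_sign q r k = (if r k then \<not> q (k + 1) else q k)"
  by (simp add: diag_sign_def)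

lemma anti_sign_low: "k < n \<Longrightarrow> anti_sign n q r k = (if q (k + 1) then r (k + 1) else \<not> r k)"
  by (simp add: anti_sign_def)

lemma anti_sign_high:
  "k < n - 1 \<Longrightarrow> anti_sign n q r (2 * n - 2 - k) = (if q (k + 1) then \<not> r k else r (k + 1))"
  by (simp add: anti_sign_def add.commute)

text \<open>Take \<open>m\<close> as the place of the first repetition of \<open>q\<close>, or
  \<open>n - 1\<close> if there is none. By the word condition \<open>r\<close> has no repetition
  from \<open>m\<close> on.\<close>

lemma word_threshold:
  assumes "word n q r" "n \<ge> 2"
  obtains m where "1 \<le> m" "m < n"
    "\<And>k. 1 \<le> k \<Longrightarrow> k \<le> m \<Longrightarrow> q k \<longleftrightarrow> (q m \<longleftrightarrow> (even k \<longleftrightarrow> even m))"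
    "\<And>k. m \<le> k \<Longrightarrow> k < n \<Longrightarrow> r k \<longleftrightarrow> (r m \<longleftrightarrow> (even k \<longleftrightarrow> even m))"
proof -
  have "\<exists>m. 1 \<le> m \<and> m < n \<and> (\<forall>k. 1 \<le> k \<and> k < m \<longrightarrow> q k \<noteq> q (k + 1)) \<and> (\<forall>k. m \<le> k \<and> k + 1 < n \<longrightarrow> r k \<noteq> r (k + 1))"
  proof (cases "\<exists>k. 1 \<le> k \<and> k + 1 < n \<and> q k = q (k + 1)")
    case True
    let ?P = "\<lambda>i. 1 + int i + 1 < n \<and> q (1 + int i) = q (1 + int i + 1)"
    obtain k where k: "1 \<le> k" "k + 1 < n" "q k = q (k + 1)" using True by blast
    have "1 + int (nat (k - 1)) = k" using k(1) by simp
    then have "?P (nat (k - 1))" using k(2,3) by simp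
    then obtain i where i: "?P i" "\<And>l. l < i \<Longrightarrow> \<not> ?P l"
      using exists_least_iff[of ?P] by blast
    have "q l \<noteq> q (l + 1)" if "1 \<le> l" "l < 1 + int i" for l
    proof -
      have e: "1 + int (nat (l - 1)) = l" and l: "nat (l - 1) < i" "l + 1 < n" using that i(1) by linarith+
      show ?thesis using i(2)[OF l(1), unfolded e] l(2) by blast
    qed
    moreover have "r l \<noteq> r (l + 1)" if "1 + int i \<le> l" "l + 1 < n" for l
    proof -
      have "1 \<le> 1 + int i" "l \<le> n - 2" using that by linarith+
      then show ?thesis using assms(1) that i(1) unfolding word_def by blast
    qed
    moreover have "1 \<le> 1 + int i" "1 + int i < n" using i(1) by linarith+
    ultimately show ?thesis by blast
  next
    case False
    then have "\<forall>k. 1 \<le> k \<and> k < n - 1 \<longrightarrow> q k \<noteq> q (k + 1)" by auto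
    then show ?thesis using assms(2) by (intro exI[of _ "n - 1"]) auto
  qed
  then obtain m where m: "1 \<le> m" "m < n" "\<And>k. 1 \<le> k \<Longrightarrow> k < m \<Longrightarrow> q k \<noteq> q (k + 1)"
    "\<And>k. m \<le> k \<Longrightarrow> k + 1 < n \<Longrightarrow> r k \<noteq> r (k + 1)" by blast
  have "q k \<longleftrightarrow> (q m \<longleftrightarrow> (even k \<longleftrightarrow> even m))" if "1 \<le> k" "k \<le> m" for k
  proof -
    have "q m \<longleftrightarrow> (q k \<longleftrightarrow> even (m - k))"
      by (rule alternating_parity[where f = q]) (use that m(3) in auto)
    then show ?thesis by auto
  qed
  moreover have "r k \<longleftrightarrow> (r m \<longleftrightarrow> (even k \<longleftrightarrow> even m))" if "m \<le> k" "k < n" for k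
  proof -
    have "r k \<longleftrightarrow> (r m \<longleftrightarrow> even (k - m))"
      by (rule alternating_parity[where f = r]) (use that m(4) in auto)
    then show ?thesis by auto
  qed
  ultimately show thesis using that m(1,2) by blast
qed

text \<open>
  At \<open>m\<close> the word changes from alternating \<open>q\<close> to alternating \<open>r\<close>, so that signs
  alternate on the diagonals and antidiagonals through the middle of the grid.
\<close>

locale split_word =
  fixes n m :: int and q r :: "int \<Rightarrow> bool"
  assumes m: "1 \<le> m" "m < n"
    and q_low: "1 \<le> k \<Longrightarrow> k \<le> m \<Longrightarrow> q k \<longleftrightarrow> (q m \<longleftrightarrow> (even k \<longleftrightarrow> even m))"
    and r_high: "m \<le> k \<Longrightarrow> k < n \<Longrightarrow> r k \<longleftrightarrow> (r m \<longleftrightarrow> (even k \<longleftrightarrow> even m))"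
    and outside: "\<not> r 0" "\<not> q n"
begin

abbreviation "x \<equiv> diag_sign q r"
abbreviation "y \<equiv> anti_sign n q r"

text \<open>As \<open>q\<close> alternates up to \<open>m\<close>, both branches in
  \<open>diag_sign\<close> give the same value, independent of \<open>r\<close>. On these diagonals
  the signs therefore alternate strictly.\<close>

lemma x_inner:
  assumes "- m < s" "s < m"
  shows "x s \<longleftrightarrow> (q m \<longleftrightarrow> (even s \<longleftrightarrow> even m))"
proof -
  consider k where "s = - k" "0 = k" | k where "s = - k" "0 < k" "k < m" | "0 < s"
    using assms by (metis add.inverse_inverse linorder_neqE neg_0_less_iff_less neg_less_iff_less)
  then show ?thesis
  proof cases
    case 1
    then show ?thesis using diag_sign_minus[of k q r] q_low[of 1] m outside by auto
  next
    case 2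
    then show ?thesis using diag_sign_minus[of k q r] q_low[of k] q_low[of "k + 1"] by auto
  next
    case 3
    then show ?thesis using diag_sign_plus[of s q r] q_low[of s] q_low[of "s + 1"] assms by auto
  qed
qed

lemma y_inner:
  assumes "m \<le> t" "t \<le> 2 * n - 2 - m"
  shows "y t \<longleftrightarrow> \<not> (r m \<longleftrightarrow> (even t \<longleftrightarrow> even m))"
proof -
  consider "t < n - 1" | "t = n - 1" | k where "t = 2 * n - 2 - k" "m \<le> k" "k < n - 1"
  proof -
    assume a: "t < n - 1 \<Longrightarrow> thesis" "t = n - 1 \<Longrightarrow> thesis"
      "\<And>k. t = 2 * n - 2 - k \<Longrightarrow> m \<le> k \<Longrightarrow> k < n - 1 \<Longrightarrow> thesis"
    show thesis using a(1,2) a(3)[of "2 * n - 2 - t"] assms by linarith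
  qed
  then show ?thesis
  proof cases
    case 1
    then show ?thesis using anti_sign_low[of t n q r] r_high[of t] r_high[of "t + 1"] assms by auto
  next
    case 2
    then show ?thesis using anti_sign_low[of t n q r] r_high[of t] assms outside by auto
  next
    case 3
    then show ?thesis using anti_sign_high[of k n q r] r_high[of k] r_high[of "k + 1"] by auto
  qed
qed

text \<open>Repetitions of \<open>x\<close> have a parity fixed by \<open>r m\<close>. None occurs
  for \<open>\<bar>s\<bar> < m\<close>. Farther out \<open>r\<close> alternates, and if
  \<open>r a\<close> holds with \<open>m \<le> a\<close>, the diagonals \<open>a\<close> and
  \<open>a + 1\<close> read the single bit \<open>q (a + 1)\<close> with opposite signs, so a
  repetition needs \<open>\<not> r a\<close>. On the negative side it needs \<open>r k\<close>
  instead.\<close>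

lemma x_repeat:
  assumes "x a \<longleftrightarrow> x (a + 1)" "- n < a" "a + 1 < n"
  shows "\<not> (r m \<longleftrightarrow> (even a \<longleftrightarrow> even m))"
proof -
  consider "- m < a" "a + 1 < m" | "a = m - 1" | "m \<le> a" | "a = - m" | k where "a = - (k + 1)" "m \<le> k"
  proof -
    assume t: "- m < a \<Longrightarrow> a + 1 < m \<Longrightarrow> thesis" "a = m - 1 \<Longrightarrow> thesis" "m \<le> a \<Longrightarrow> thesis"
      "a = - m \<Longrightarrow> thesis" "\<And>k. a = - (k + 1) \<Longrightarrow> m \<le> k \<Longrightarrow> thesis"
    show thesis using t(1-4) t(5)[of "- a - 1"] by linarith
  qed
  then show ?thesis
  proof cases
    case 1
    have "even (a + 1) \<longleftrightarrow> \<not> even a" by simp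
    moreover have b: "- m < a + 1" "a < m" using 1 by simp_all
    ultimately show ?thesis using x_inner[OF 1(1) b(2)] x_inner[OF b(1) 1(2)] assms(1) by argo
  next
    case 2
    then have "x a \<longleftrightarrow> \<not> q m" using x_inner[of a] m by auto
    moreover have "x (a + 1) \<longleftrightarrow> (if r m then \<not> q (m + 1) else q m)"
      using diag_sign_plus[of m q r] m 2 by simp
    ultimately have "r m" using assms(1) by argo
    then show ?thesis using 2 by simp
  next
    case 3
    have "x a \<longleftrightarrow> (if r a then \<not> q (a + 1) else q a)" using diag_sign_plus[of a q r] 3 m by simp
    moreover have "x (a + 1) \<longleftrightarrow> (if r (a + 1) then \<not> q (a + 1 + 1) else q (a + 1))"
      using diag_sign_plus[of "a + 1" q r] 3 m by simp
    moreover have "r (a + 1) \<longleftrightarrow> \<not> r a" using r_high[of a] r_high[of "a + 1"] 3 assms(3) by auto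
    ultimately have "\<not> r a" using assms(1) by argo
    then show ?thesis using r_high[of a] 3 assms(3) by simp
  next
    case 4
    then have "x (a + 1) \<longleftrightarrow> \<not> q m" using x_inner[of "a + 1"] m by auto
    moreover have "x a \<longleftrightarrow> (if r m then q m else \<not> q (m + 1))"
      using diag_sign_minus[of m q r] m 4 by simp
    ultimately have "\<not> r m" using assms(1) by argo
    then show ?thesis using 4 by simp
  next
    case 5
    have a1: "a + 1 = - k" using 5 by simp
    have "x a \<longleftrightarrow> (if r (k + 1) then q (k + 1) else \<not> q (k + 1 + 1))"
      using diag_sign_minus[of "k + 1" q r] 5 m by simp
    moreover have "x (a + 1) \<longleftrightarrow> (if r k then q k else \<not> q (k + 1))"
      unfolding a1 using diag_sign_minus[of k q r] 5 m by simp
    moreover have "r (k + 1) \<longleftrightarrow> \<not> r k" using r_high[of k] r_high[of "k + 1"] 5 assms(2) by auto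
    ultimately have "r k" using assms(1) by argo
    then show ?thesis using r_high[of k] 5 assms(2) by simp
  qed
qed

text \<open>The counterpart for antidiagonals: near the ends it is \<open>q\<close> that alternates
  and selects the branch, so the parity of a repetition is fixed by \<open>q m\<close>.\<close>

lemma y_repeat:
  assumes "y t \<longleftrightarrow> y (t + 1)" "0 \<le> t" "t + 1 \<le> 2 * n - 2"
  shows "q m \<longleftrightarrow> (even t \<longleftrightarrow> even m)"
proof -
  consider "m \<le> t" "t + 1 \<le> 2 * n - 2 - m" | "t = m - 1" | "t + 1 < m"
    | "t = 2 * n - 2 - m" | k where "t = 2 * n - 2 - k" "1 \<le> k" "k < m"
  proof -
    assume a: "m \<le> t \<Longrightarrow> t + 1 \<le> 2 * n - 2 - m \<Longrightarrow> thesis" "t = m - 1 \<Longrightarrow> thesis" "t + 1 < m \<Longrightarrow> thesis"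
      "t = 2 * n - 2 - m \<Longrightarrow> thesis" "\<And>k. t = 2 * n - 2 - k \<Longrightarrow> 1 \<le> k \<Longrightarrow> k < m \<Longrightarrow> thesis"
    show thesis using a(1-4) a(5)[of "2 * n - 2 - t"] assms(2,3) by linarith
  qed
  then show ?thesis
  proof cases
    case 1
    have "even (t + 1) \<longleftrightarrow> \<not> even t" by simp
    moreover have b: "m \<le> t + 1" "t \<le> 2 * n - 2 - m" using 1 by simp_all
    ultimately show ?thesis using y_inner[OF 1(1) b(2)] y_inner[OF b(1) 1(2)] assms(1) by argo
  next
    case 2
    then have "y (t + 1) \<longleftrightarrow> \<not> r m" using y_inner[of "t + 1"] m by auto
    moreover have "y t \<longleftrightarrow> (if q m then r m else \<not> r t)"
      using anti_sign_low[of t n q r] m 2 by simp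
    ultimately have "\<not> q m" using assms(1) by argo
    then show ?thesis using 2 by simp
  next
    case 3
    have "y t \<longleftrightarrow> (if q (t + 1) then r (t + 1) else \<not> r t)" using anti_sign_low[of t n q r] 3 m by simp
    moreover have "y (t + 1) \<longleftrightarrow> (if q (t + 1 + 1) then r (t + 1 + 1) else \<not> r (t + 1))"
      using anti_sign_low[of "t + 1" n q r] 3 m by simp
    moreover have "q (t + 1 + 1) \<longleftrightarrow> \<not> q (t + 1)" using q_low[of "t + 1"] q_low[of "t + 1 + 1"] 3 assms(2) by auto
    ultimately have "\<not> q (t + 1)" using assms(1) by argo
    then show ?thesis using q_low[of "t + 1"] 3 assms(2) by simp
  next
    case 4
    have t1: "t + 1 = 2 * n - 2 - (m - 1)" using 4 by simp
    have "y t \<longleftrightarrow> \<not> r m" using y_inner[of t] m 4 by auto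
    moreover have "y (t + 1) \<longleftrightarrow> (if q m then \<not> r (m - 1) else r m)"
      unfolding t1 using anti_sign_high[of "m - 1" n q r] m by simp
    ultimately have "q m" using assms(1) by argo
    then show ?thesis using 4 by simp
  next
    case 5
    have t1: "t + 1 = 2 * n - 2 - (k - 1)" using 5 by simp
    have "y t \<longleftrightarrow> (if q (k + 1) then \<not> r k else r (k + 1))" using anti_sign_high[of k n q r] 5 m by simp
    moreover have "y (t + 1) \<longleftrightarrow> (if q k then \<not> r (k - 1) else r k)"
      unfolding t1 using anti_sign_high[of "k - 1" n q r] 5 m by simp
    moreover have "q (k + 1) \<longleftrightarrow> \<not> q k" using q_low[of k] q_low[of "k + 1"] 5 by auto
    ultimately have "q k" using assms(1) by argo
    then show ?thesis using q_low[of k] 5 by simp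
  qed
qed

text \<open>Where \<open>x\<close> alternates, the relation fails only if \<open>x s\<close> is
  false and \<open>y\<close> repeats at \<open>t\<close>; but such a repetition has the parity for
  which \<open>x s\<close> is true. Where \<open>y\<close> alternates, the roles of \<open>x\<close>
  and \<open>y\<close> are exchanged.\<close>

lemma signs_vertical:
  assumes "0 \<le> i" "i + 1 < n" "0 \<le> j" "j < n"
  shows "\<not> x (i - j) \<and> \<not> y (i + j) \<longleftrightarrow> x (i - j + 1) \<and> y (i + j + 1)"
proof -
  define s t where st: "s = i - j" "t = i + j"
  have par: "even s \<longleftrightarrow> even t" "even (s + 1) \<longleftrightarrow> \<not> even s" "even (t + 1) \<longleftrightarrow> \<not> even t" by (simp_all add: st)
  have bounds: "- n < s" "s + 1 < n" "0 \<le> t" "t + 1 \<le> 2 * n - 2" using assms by (simp_all add: st)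
  have rep: "x s = x (s + 1) \<longrightarrow> \<not> (r m \<longleftrightarrow> (even s \<longleftrightarrow> even m))" "y t = y (t + 1) \<longrightarrow> (q m \<longleftrightarrow> (even t \<longleftrightarrow> even m))"
    using x_repeat[OF _ bounds(1,2)] y_repeat[OF _ bounds(3,4)] by blast+
  \<comment> \<open>Outside both strips the bounds of the grid leave two places: the dimer positions
    at the left and right corners of rectangle \<open>m\<close>. Here one neighbour on each side has
    a known sign, and both repetition rules are needed.\<close>
  consider "- m < s" "s + 1 < m" | "m \<le> t" "t + 1 \<le> 2 * n - 2 - m" | "s = m - 1" "t = m - 1" | "s = - m" "t = 2 * n - 2 - m"
    using assms unfolding st by smt
  then have "\<not> x s \<and> \<not> y t \<longleftrightarrow> x (s + 1) \<and> y (t + 1)"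
  proof cases
    case 1
    then have "x s \<longleftrightarrow> (q m \<longleftrightarrow> (even s \<longleftrightarrow> even m))" "x (s + 1) \<longleftrightarrow> (q m \<longleftrightarrow> (even (s + 1) \<longleftrightarrow> even m))"
      by (intro x_inner; linarith)+
    then show ?thesis using par rep by argo
  next
    case 2
    then have "y t \<longleftrightarrow> \<not> (r m \<longleftrightarrow> (even t \<longleftrightarrow> even m))" "y (t + 1) \<longleftrightarrow> \<not> (r m \<longleftrightarrow> (even (t + 1) \<longleftrightarrow> even m))"
      by (intro y_inner; linarith)+
    then show ?thesis using par rep by argo
  next
    case 3
    then have "x s \<longleftrightarrow> \<not> q m" "y (t + 1) \<longleftrightarrow> \<not> r m" "even s \<longleftrightarrow> \<not> even m"
      using x_inner[of s] y_inner[of "t + 1"] m by auto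
    then show ?thesis using par rep by argo
  next
    case 4
    then have "x (s + 1) \<longleftrightarrow> \<not> q m" "y t \<longleftrightarrow> \<not> r m" "even s \<longleftrightarrow> even m"
      using x_inner[of "s + 1"] y_inner[of t] m by auto
    then show ?thesis using par rep by argo
  qed
  then show ?thesis by (simp add: st)
qed

lemma signs_horizontal:
  assumes "0 \<le> i" "i < n" "0 \<le> j" "j + 1 < n"
  shows "\<not> x (i - j) \<and> y (i + j) \<longleftrightarrow> x (i - j - 1) \<and> \<not> y (i + j + 1)"
proof -
  define s t where st: "s = i - j - 1" "t = i + j"
  have par: "even s \<longleftrightarrow> \<not> even t" "even (s + 1) \<longleftrightarrow> \<not> even s" "even (t + 1) \<longleftrightarrow> \<not> even t" by (simp_all add: st)
  have bounds: "- n < s" "s + 1 < n" "0 \<le> t" "t + 1 \<le> 2 * n - 2" using assms by (simp_all add: st)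
  have rep: "x s = x (s + 1) \<longrightarrow> \<not> (r m \<longleftrightarrow> (even s \<longleftrightarrow> even m))" "y t = y (t + 1) \<longrightarrow> (q m \<longleftrightarrow> (even t \<longleftrightarrow> even m))"
    using x_repeat[OF _ bounds(1,2)] y_repeat[OF _ bounds(3,4)] by blast+
  \<comment> \<open>The exceptional places are now the top and bottom corners of rectangle
    \<open>m\<close>.\<close>
  consider "- m < s" "s + 1 < m" | "m \<le> t" "t + 1 \<le> 2 * n - 2 - m" | "s = - m" "t = m - 1" | "s = m - 1" "t = 2 * n - 2 - m"
    using assms unfolding st by smt
  then have "\<not> x (s + 1) \<and> y t \<longleftrightarrow> x s \<and> \<not> y (t + 1)"
  proof cases
    case 1
    then have "x s \<longleftrightarrow> (q m \<longleftrightarrow> (even s \<longleftrightarrow> even m))" "x (s + 1) \<longleftrightarrow> (q m \<longleftrightarrow> (even (s + 1) \<longleftrightarrow> even m))"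
      by (intro x_inner; linarith)+
    then show ?thesis using par rep by argo
  next
    case 2
    then have "y t \<longleftrightarrow> \<not> (r m \<longleftrightarrow> (even t \<longleftrightarrow> even m))" "y (t + 1) \<longleftrightarrow> \<not> (r m \<longleftrightarrow> (even (t + 1) \<longleftrightarrow> even m))"
      by (intro y_inner; linarith)+
    then show ?thesis using par rep by argo
  next
    case 3
    then have "x (s + 1) \<longleftrightarrow> \<not> q m" "y (t + 1) \<longleftrightarrow> \<not> r m" "even s \<longleftrightarrow> even m"
      using x_inner[of "s + 1"] y_inner[of "t + 1"] m by auto
    then show ?thesis using par rep by argo
  next
    case 4
    then have "x s \<longleftrightarrow> \<not> q m" "y t \<longleftrightarrow> \<not> r m" "even s \<longleftrightarrow> \<not> even m"
      using x_inner[of s] y_inner[of t] m by auto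
    then show ?thesis using par rep by argo
  qed
  then show ?thesis by (simp add: st)
qed

end

lemma word_outside:
  assumes "word n q r"
  shows "\<not> q 0" "\<not> r 0" "\<not> q n" "\<not> r n"
  using assms unfolding word_def by fastforce+

lemma word_signs:
  assumes "word n q r"
  shows word_horizontal: "0 \<le> i \<Longrightarrow> i < n \<Longrightarrow> 0 \<le> j \<Longrightarrow> j + 1 < n \<Longrightarrow>
      \<not> diag_sign q r (i - j) \<and> anti_sign n q r (i + j) \<longleftrightarrow> diag_sign q r (i - j - 1) \<and> \<not> anti_sign n q r (i + j + 1)"
    and word_vertical: "0 \<le> i \<Longrightarrow> i + 1 < n \<Longrightarrow> 0 \<le> j \<Longrightarrow> j < n \<Longrightarrow>
      \<not> diag_sign q r (i - j) \<and> \<not> anti_sign n q r (i + j) \<longleftrightarrow> diag_sign q r (i - j + 1) \<and> anti_sign n q r (i + j + 1)"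
proof -
  have split: "\<exists>m. split_word n m q r" if n: "n \<ge> 2"
  proof -
    from word_threshold[OF assms n] obtain m where "1 \<le> m" "m < n"
      "\<And>k. 1 \<le> k \<Longrightarrow> k \<le> m \<Longrightarrow> q k \<longleftrightarrow> (q m \<longleftrightarrow> (even k \<longleftrightarrow> even m))"
      "\<And>k. m \<le> k \<Longrightarrow> k < n \<Longrightarrow> r k \<longleftrightarrow> (r m \<longleftrightarrow> (even k \<longleftrightarrow> even m))"
      by blast
    then have "split_word n m q r" using word_outside[OF assms] by unfold_locales
    then show ?thesis ..
  qed
  show "\<not> diag_sign q r (i - j) \<and> anti_sign n q r (i + j) \<longleftrightarrow> diag_sign q r (i - j - 1) \<and> \<not> anti_sign n q r (i + j + 1)"
    if "0 \<le> i" "i < n" "0 \<le> j" "j + 1 < n"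
  proof -
    have "n \<ge> 2" using that by linarith
    then obtain m where "split_word n m q r" using split by blast
    from split_word.signs_horizontal[OF this that] show ?thesis .
  qed
  show "\<not> diag_sign q r (i - j) \<and> \<not> anti_sign n q r (i + j) \<longleftrightarrow> diag_sign q r (i - j + 1) \<and> anti_sign n q r (i + j + 1)"
    if "0 \<le> i" "i + 1 < n" "0 \<le> j" "j < n"
  proof -
    have "n \<ge> 2" using that by linarith
    then obtain m where "split_word n m q r" using split by blast
    from split_word.signs_vertical[OF this that] show ?thesis .
  qed
qed

definition word_h :: "int \<Rightarrow> (int \<Rightarrow> bool) \<Rightarrow> (int \<Rightarrow> bool) \<Rightarrow> int \<Rightarrow> int \<Rightarrow> bool" where
  "word_h n q r i j \<longleftrightarrow> 0 \<le> i \<and> i < n \<and> 0 \<le> j \<and> j + 1 < n \<and> \<not> diag_sign q r (i - j) \<and> anti_sign n q r (i + j)"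

definition word_v :: "int \<Rightarrow> (int \<Rightarrow> bool) \<Rightarrow> (int \<Rightarrow> bool) \<Rightarrow> int \<Rightarrow> int \<Rightarrow> bool" where
  "word_v n q r i j \<longleftrightarrow> 0 \<le> i \<and> i + 1 < n \<and> 0 \<le> j \<and> j < n \<and> \<not> diag_sign q r (i - j) \<and> \<not> anti_sign n q r (i + j)"

lemma word_h_left:
  assumes "word n q r" "0 \<le> i" "i < n" "0 < j" "j < n"
  shows "word_h n q r i (j - 1) \<longleftrightarrow> diag_sign q r (i - j) \<and> \<not> anti_sign n q r (i + j)"
proof -
  have e: "i - (j - 1) - 1 = i - j" "i + (j - 1) + 1 = i + j" by simp_all
  have "\<not> diag_sign q r (i - (j - 1)) \<and> anti_sign n q r (i + (j - 1)) \<longleftrightarrow> diag_sign q r (i - j) \<and> \<not> anti_sign n q r (i + j)"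
    by (rule word_horizontal[OF assms(1), of i "j - 1", unfolded e]) (use assms in simp_all)
  then show ?thesis using assms unfolding word_h_def by simp
qed

lemma word_v_up:
  assumes "word n q r" "0 < i" "i < n" "0 \<le> j" "j < n"
  shows "word_v n q r (i - 1) j \<longleftrightarrow> diag_sign q r (i - j) \<and> anti_sign n q r (i + j)"
proof -
  have e: "i - 1 - j + 1 = i - j" "i - 1 + j + 1 = i + j" by simp_all
  have "\<not> diag_sign q r (i - 1 - j) \<and> \<not> anti_sign n q r (i - 1 + j) \<longleftrightarrow> diag_sign q r (i - j) \<and> anti_sign n q r (i + j)"
    by (rule word_vertical[OF assms(1), of "i - 1" j, unfolded e]) (use assms in simp_all)
  then show ?thesis using assms unfolding word_v_def by simp
qed

text \<open>Overlapping dimers would give their common cell two different sign pairs. An interior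
  point \<open>(i, j)\<close> is covered because both cells meeting there on the diagonal have the
  same sign: either \<open>(i, j)\<close> points up-left, or \<open>(i - 1, j - 1)\<close> points
  down-right, and neither arrow leaves the grid.\<close>

lemma tatami_word:
  assumes w: "word n q r" and n: "n \<ge> 1"
  shows "tatami n (word_h n q r) (word_v n q r)"
proof
  let ?h = "word_h n q r" and ?v = "word_v n q r"
  show "n \<ge> 1" by (fact n)
  show h_in: "0 \<le> i \<and> i < n \<and> 0 \<le> j \<and> j + 1 < n" if "?h i j" for i j
    using that by (simp add: word_h_def)
  show v_in: "0 \<le> i \<and> i + 1 < n \<and> 0 \<le> j \<and> j < n" if "?v i j" for i j
    using that by (simp add: word_v_def)
  have h_left: "diag_sign q r (i - (j + 1)) \<and> \<not> anti_sign n q r (i + (j + 1))" if "?h i j" for i j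
    using word_h_left[OF w, of i "j + 1"] h_in[OF that] that by simp
  have v_up: "diag_sign q r (i + 1 - j) \<and> anti_sign n q r (i + 1 + j)" if "?v i j" for i j
    using word_v_up[OF w, of "i + 1" j] v_in[OF that] that by simp
  show "\<not> ?h i (j + 1)" if "?h i j" for i j
    using h_left[OF that] unfolding word_h_def by blast
  show "\<not> ?v (i + 1) j" if "?v i j" for i j
    using v_up[OF that] unfolding word_v_def by blast
  show "\<not> ?v i j \<and> \<not> ?v i (j + 1) \<and> \<not> ?v (i - 1) j \<and> \<not> ?v (i - 1) (j + 1)" if h: "?h i j" for i j
  proof (intro conjI notI)
    assume "?v i j"
    then show False using h unfolding word_h_def word_v_def by blast
  next
    assume "?v i (j + 1)"
    then show False using h_left[OF h] unfolding word_v_def by blast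
  next
    assume "?v (i - 1) j"
    from v_up[OF this] show False using h unfolding word_h_def by simp
  next
    assume "?v (i - 1) (j + 1)"
    from v_up[OF this] show False using h_left[OF h] by simp
  qed
  show "?h (i - 1) (j - 1) \<or> ?h i (j - 1) \<or> ?v (i - 1) (j - 1) \<or> ?v (i - 1) j"
    if ij: "0 < i" "i < n" "0 < j" "j < n" for i j
  proof (cases "diag_sign q r (i - j)")
    case True
    then show ?thesis using word_h_left[OF w, of i j] word_v_up[OF w, of i j] ij by auto
  next
    case False
    then show ?thesis unfolding word_h_def word_v_def using ij by auto
  qed
qed

text \<open>There are four border cells on the diagonals \<open>k\<close>, \<open>- k\<close> and
  the antidiagonals \<open>k\<close>, \<open>2 * n - 2 - k\<close>. Exactly one of them points
  outward, and the bits \<open>r k\<close> and \<open>q (k + 1)\<close> select it.\<close>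

definition word_monomer :: "int \<Rightarrow> (int \<Rightarrow> bool) \<Rightarrow> (int \<Rightarrow> bool) \<Rightarrow> int \<Rightarrow> int \<times> int" where
  "word_monomer n q r k = (if r k then (if q (k + 1) then (n - 1, n - 1 - k) else (k, 0))
     else (if q (k + 1) then (n - 1 - k, n - 1) else (0, k)))"

text \<open>The word condition enters with \<open>k = l\<close>: repetitions of \<open>q\<close> and
  \<open>r\<close> at the same place would make two opposite cells of the four point outward. At
  \<open>k = 0\<close> and \<open>k = n - 1\<close> the dummy bits play the part of the corner
  convention.\<close>

lemma outward_cells:
  assumes w: "word n q r" and k: "0 \<le> k" "k < n"
  shows "diag_sign q r (- k) \<and> anti_sign n q r k \<longleftrightarrow> \<not> r k \<and> \<not> q (k + 1)"
    "diag_sign q r k \<and> \<not> anti_sign n q r k \<longleftrightarrow> r k \<and> \<not> q (k + 1)"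
    "\<not> diag_sign q r k \<and> \<not> anti_sign n q r (2 * n - 2 - k) \<longleftrightarrow> r k \<and> q (k + 1)"
    "\<not> diag_sign q r (- k) \<and> anti_sign n q r (2 * n - 2 - k) \<longleftrightarrow> \<not> r k \<and> q (k + 1)"
proof -
  note out = word_outside[OF w]
  have step: "\<not> ((q k \<longleftrightarrow> q (k + 1)) \<and> (r k \<longleftrightarrow> r (k + 1)))" if "1 \<le> k" "k < n - 1"
    using w that unfolding word_def by force
  have minus: "diag_sign q r (- k) \<longleftrightarrow> (if r k then q k else \<not> q (k + 1))"
    using diag_sign_minus k by simp
  have low: "anti_sign n q r k \<longleftrightarrow> (if q (k + 1) then r (k + 1) else \<not> r k)"
    using anti_sign_low k by simp
  have last: "\<not> q (k + 1)" "anti_sign n q r (2 * n - 2 - k) \<longleftrightarrow> anti_sign n q r k" if "k = n - 1"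
    using out that by simp_all
  have high: "anti_sign n q r (2 * n - 2 - k) \<longleftrightarrow> (if q (k + 1) then \<not> r k else r (k + 1))" if "k < n - 1"
    using anti_sign_high[OF that] by simp
  have plus: "diag_sign q r k \<longleftrightarrow> (if r k then \<not> q (k + 1) else q k)" if "0 < k"
    using diag_sign_plus that by simp
  consider "k = 0" "n = 1" | "k = 0" "k < n - 1" | "0 < k" "k = n - 1" | "1 \<le> k" "k < n - 1" using k by linarith
  then have "(diag_sign q r (- k) \<and> anti_sign n q r k \<longleftrightarrow> \<not> r k \<and> \<not> q (k + 1)) \<and>
    (diag_sign q r k \<and> \<not> anti_sign n q r k \<longleftrightarrow> r k \<and> \<not> q (k + 1)) \<and>
    (\<not> diag_sign q r k \<and> \<not> anti_sign n q r (2 * n - 2 - k) \<longleftrightarrow> r k \<and> q (k + 1)) \<and>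
    (\<not> diag_sign q r (- k) \<and> anti_sign n q r (2 * n - 2 - k) \<longleftrightarrow> \<not> r k \<and> q (k + 1))"
  proof cases
    case 1
    then have e: "\<not> r k" "diag_sign q r k = diag_sign q r (- k)" "k = n - 1" using out by simp_all
    have "diag_sign q r (- k)" "anti_sign n q r k" using minus low last(1)[OF e(3)] e(1) by simp_all
    then show ?thesis using last[OF e(3)] e(1,2) by simp
  next
    case 2
    then have "\<not> r k" "diag_sign q r k = diag_sign q r (- k)" using out by simp_all
    then show ?thesis using minus low high[OF 2(2)] by argo
  next
    case 3
    show ?thesis using minus low last[OF 3(2)] plus[OF 3(1)] by argo
  next
    case 4
    then have "0 < k" by simp
    show ?thesis using minus low high[OF 4(2)] plus[OF \<open>0 < k\<close>] step[OF 4] by argo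
  qed
  then show "diag_sign q r (- k) \<and> anti_sign n q r k \<longleftrightarrow> \<not> r k \<and> \<not> q (k + 1)"
    "diag_sign q r k \<and> \<not> anti_sign n q r k \<longleftrightarrow> r k \<and> \<not> q (k + 1)"
    "\<not> diag_sign q r k \<and> \<not> anti_sign n q r (2 * n - 2 - k) \<longleftrightarrow> r k \<and> q (k + 1)"
    "\<not> diag_sign q r (- k) \<and> anti_sign n q r (2 * n - 2 - k) \<longleftrightarrow> \<not> r k \<and> q (k + 1)"
    by blast+
qed

text \<open>A cell is left to a monomer exactly if its arrow leaves the grid: the disjuncts are up,
  left, down and right.\<close>

lemma uncovered_word_iff:
  assumes w: "word n q r" and n: "n \<ge> 1"
  shows "tatami.uncovered n (word_h n q r) (word_v n q r) i j \<longleftrightarrow> 0 \<le> i \<and> i < n \<and> 0 \<le> j \<and> j < n \<and>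
    (i = 0 \<and> diag_sign q r (i - j) \<and> anti_sign n q r (i + j) \<or>
     j = 0 \<and> diag_sign q r (i - j) \<and> \<not> anti_sign n q r (i + j) \<or>
     i = n - 1 \<and> \<not> diag_sign q r (i - j) \<and> \<not> anti_sign n q r (i + j) \<or>
     j = n - 1 \<and> \<not> diag_sign q r (i - j) \<and> anti_sign n q r (i + j))"
proof (cases "0 \<le> i \<and> i < n \<and> 0 \<le> j \<and> j < n")
  case True
  have "word_h n q r i (j - 1) \<longleftrightarrow> j \<noteq> 0 \<and> diag_sign q r (i - j) \<and> \<not> anti_sign n q r (i + j)"
    using word_h_left[OF w, of i j] True by (cases "j = 0") (auto simp: word_h_def)
  moreover have "word_v n q r (i - 1) j \<longleftrightarrow> i \<noteq> 0 \<and> diag_sign q r (i - j) \<and> anti_sign n q r (i + j)"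
    using word_v_up[OF w, of i j] True by (cases "i = 0") (auto simp: word_v_def)
  moreover have "word_h n q r i j \<longleftrightarrow> j \<noteq> n - 1 \<and> \<not> diag_sign q r (i - j) \<and> anti_sign n q r (i + j)"
    "word_v n q r i j \<longleftrightarrow> i \<noteq> n - 1 \<and> \<not> diag_sign q r (i - j) \<and> \<not> anti_sign n q r (i + j)"
    using True by (auto simp: word_h_def word_v_def)
  ultimately show ?thesis
    unfolding tatami.uncovered_def[OF tatami_word[OF w n]] using True by argo
next
  case False
  then show ?thesis unfolding tatami.uncovered_def[OF tatami_word[OF w n]] by blast
qed

lemma uncovered_word:
  assumes w: "word n q r" and n: "n \<ge> 1"
  shows "{(i, j). tatami.uncovered n (word_h n q r) (word_v n q r) i j} = word_monomer n q r ` {0..<n}" (is "?U = _")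
proof (intro set_eqI iffI)
  fix c assume "c \<in> ?U"
  then obtain i j where c: "c = (i, j)" and u: "tatami.uncovered n (word_h n q r) (word_v n q r) i j" by blast
  note u = u[unfolded uncovered_word_iff[OF w n]]
  then consider "i = 0" "diag_sign q r (- j)" "anti_sign n q r j"
    | "j = 0" "diag_sign q r i" "\<not> anti_sign n q r i"
    | "i = n - 1" "\<not> diag_sign q r (n - 1 - j)" "\<not> anti_sign n q r (2 * n - 2 - (n - 1 - j))"
    | "j = n - 1" "\<not> diag_sign q r (- (n - 1 - i))" "anti_sign n q r (2 * n - 2 - (n - 1 - i))"
    by (auto simp: algebra_simps)
  then show "c \<in> word_monomer n q r ` {0..<n}"
  proof cases
    case 1
    have "\<not> r j \<and> \<not> q (j + 1)" using outward_cells(1)[OF w, of j] 1(2,3) u by blast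
    then show ?thesis using u 1(1) c by (intro image_eqI[of _ _ j]) (auto simp: word_monomer_def)
  next
    case 2
    have "r i \<and> \<not> q (i + 1)" using outward_cells(2)[OF w, of i] 2(2,3) u by blast
    then show ?thesis using u 2(1) c by (intro image_eqI[of _ _ i]) (auto simp: word_monomer_def)
  next
    case 3
    have "0 \<le> n - 1 - j" "n - 1 - j < n" using u by simp_all
    then have "r (n - 1 - j) \<and> q (n - 1 - j + 1)" using outward_cells(3)[OF w, of "n - 1 - j"] 3(2,3) by blast
    then show ?thesis using u 3(1) c by (intro image_eqI[of _ _ "n - 1 - j"]) (auto simp: word_monomer_def)
  next
    case 4
    have "0 \<le> n - 1 - i" "n - 1 - i < n" using u by simp_all
    then have "\<not> r (n - 1 - i) \<and> q (n - 1 - i + 1)" using outward_cells(4)[OF w, of "n - 1 - i"] 4(2,3) by blast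
    then show ?thesis using u 4(1) c by (intro image_eqI[of _ _ "n - 1 - i"]) (auto simp: word_monomer_def)
  qed
next
  fix c assume "c \<in> word_monomer n q r ` {0..<n}"
  then obtain k where k: "0 \<le> k" "k < n" and c: "c = word_monomer n q r k" by auto
  note o = outward_cells[OF w k]
  have e: "n - 1 - (n - 1 - k) = k" "n - 1 + (n - 1 - k) = 2 * n - 2 - k" "n - 1 - k - (n - 1) = - k"
    "n - 1 - k + (n - 1) = 2 * n - 2 - k" "0 - k = - k" "0 + k = k" "k - 0 = k" "k + 0 = k" by simp_all
  have b: "0 \<le> n - 1 - k" "n - 1 - k < n" "0 \<le> n - 1" "n - 1 < n" "(0 :: int) \<le> 0" "0 < n" using k by simp_all
  consider "r k" "q (k + 1)" | "r k" "\<not> q (k + 1)" | "\<not> r k" "q (k + 1)" | "\<not> r k" "\<not> q (k + 1)" by blast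
  then show "c \<in> ?U"
  proof cases
    case 1
    then have "c = (n - 1, n - 1 - k)" by (simp add: c word_monomer_def)
    moreover have "tatami.uncovered n (word_h n q r) (word_v n q r) (n - 1) (n - 1 - k)"
      unfolding uncovered_word_iff[OF w n] e using o(3) 1 b by blast
    ultimately show ?thesis by blast
  next
    case 2
    then have "c = (k, 0)" by (simp add: c word_monomer_def)
    moreover have "tatami.uncovered n (word_h n q r) (word_v n q r) k 0"
      unfolding uncovered_word_iff[OF w n] e using o(2) 2 b k by blast
    ultimately show ?thesis by blast
  next
    case 3
    then have "c = (n - 1 - k, n - 1)" by (simp add: c word_monomer_def)
    moreover have "tatami.uncovered n (word_h n q r) (word_v n q r) (n - 1 - k) (n - 1)"
      unfolding uncovered_word_iff[OF w n] e using o(4) 3 b by blast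
    ultimately show ?thesis by blast
  next
    case 4
    then have "c = (0, k)" by (simp add: c word_monomer_def)
    moreover have "tatami.uncovered n (word_h n q r) (word_v n q r) 0 k"
      unfolding uncovered_word_iff[OF w n] e using o(1) 4 b k by blast
    ultimately show ?thesis by blast
  qed
qed

lemma max_tatami_word:
  assumes w: "word n q r" and n: "n \<ge> 1"
  shows "max_tatami n (word_h n q r) (word_v n q r)"
proof -
  \<comment> \<open>Two of the candidate cells coincide only at corners of the grid, and then they
    belong to the same \<open>k\<close>.\<close>
  have "inj_on (word_monomer n q r) {0..<n}"
    by (rule inj_onI) (auto simp: word_monomer_def split: if_splits)
  then have "card {(i, j). tatami.uncovered n (word_h n q r) (word_v n q r) i j} = nat n"
    unfolding uncovered_word[OF w n] by (simp add: card_image)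
  then show ?thesis
    using tatami_word[OF w n] by (simp add: max_tatami_def max_tatami_axioms_def)
qed

text \<open>The bits can be read off the dimers at the corners of rectangle \<open>k\<close>: top,
  left and right stand for both bits, only \<open>q\<close>, only \<open>r\<close>; if all three are
  absent, both bits are false.\<close>

lemma word_eq_if_dimers_eq:
  assumes w: "word n q r" "word n q' r'" and n: "n \<ge> 1"
    and eq: "word_h n q r = word_h n q' r'" "word_v n q r = word_v n q' r'"
  shows "q = q' \<and> r = r'"
proof -
  have b: "(q k \<and> r k \<longleftrightarrow> word_h n q r 0 (k - 1)) \<and> (q k \<and> \<not> r k \<longleftrightarrow> word_v n q r (k - 1) 0) \<and>
     (\<not> q k \<and> r k \<longleftrightarrow> word_v n q r (n - k - 1) (n - 1))"
    if w: "word n q r" and k: "1 \<le> k" "k < n" for q r k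
  proof -
    have k': "0 \<le> k - 1" "k - 1 < n" "0 \<le> k" and e: "k - 1 + 1 = k" using k by simp_all
    note o = outward_cells[OF w k'(1,2), unfolded e] outward_cells[OF w k'(3) k(2)]
    have "word_h n q r 0 (k - 1) \<longleftrightarrow> diag_sign q r (- k) \<and> \<not> anti_sign n q r k"
      using word_h_left[OF w, of 0 k] k by simp
    moreover have "word_v n q r (k - 1) 0 \<longleftrightarrow> diag_sign q r k \<and> anti_sign n q r k"
      using word_v_up[OF w, of k 0] k by simp
    moreover have "word_v n q r (n - k - 1) (n - 1) \<longleftrightarrow> \<not> diag_sign q r (- k) \<and> \<not> anti_sign n q r (2 * n - 2 - k)"
      using k by (simp add: word_v_def algebra_simps)
    moreover have "word_h n q r 0 (k - 1) \<longleftrightarrow> \<not> diag_sign q r (- (k - 1)) \<and> anti_sign n q r (k - 1)"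
      using k by (simp add: word_h_def)
    moreover have "word_v n q r (k - 1) 0 \<longleftrightarrow> \<not> diag_sign q r (k - 1) \<and> \<not> anti_sign n q r (k - 1)"
      using k by (simp add: word_v_def)
    moreover have "diag_sign q r (- k) \<longleftrightarrow> (if r k then q k else \<not> q (k + 1))"
      using diag_sign_minus k by simp
    moreover have "anti_sign n q r (k - 1) \<longleftrightarrow> (if q k then r k else \<not> r (k - 1))"
      using anti_sign_low[of "k - 1" n q r] k by simp
    moreover have "diag_sign q r k \<longleftrightarrow> (if r k then \<not> q (k + 1) else q k)"
      using diag_sign_plus k by simp
    moreover have "anti_sign n q r k \<longleftrightarrow> (if q (k + 1) then r (k + 1) else \<not> r k)"
      using anti_sign_low k by simp
    ultimately show ?thesis using o by argo
  qed
  have "q k = q' k \<and> r k = r' k" for k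
  proof (cases "1 \<le> k \<and> k < n")
    case True
    then have k: "1 \<le> k" "k < n" by simp_all
    show ?thesis using b[OF w(1) k] b[OF w(2) k, folded eq] by blast
  next
    case False
    then show ?thesis using w unfolding word_def by blast
  qed
  then show ?thesis by blast
qed

subsection \<open>Counting words\<close>

definition words :: "int \<Rightarrow> ((int \<Rightarrow> bool) \<times> (int \<Rightarrow> bool)) set" where
  "words n = {(q, r). word n q r}"

definition alternating_words :: "int \<Rightarrow> ((int \<Rightarrow> bool) \<times> (int \<Rightarrow> bool)) set" where
  "alternating_words n = {(q, r). word n q r \<and> (\<forall>k. 1 \<le> k \<and> k < n - 1 \<longrightarrow> q k \<noteq> q (k + 1))}"

text \<open>The new letter allows repetitions at \<open>n - 1\<close>, the last possible place. One
  of \<open>r\<close> there clashes with every repetition of \<open>q\<close>; one of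
  \<open>q\<close> there clashes only if \<open>r\<close> repeats there as well.\<close>

lemma word_Suc:
  assumes "n \<ge> 2"
  shows "word (n + 1) q r \<longleftrightarrow> word n (q(n := False)) (r(n := False)) \<and>
    (r n \<noteq> r (n - 1) \<or> (\<forall>k. 1 \<le> k \<and> k < n \<longrightarrow> q k \<noteq> q (k + 1)))"
proof
  assume w: "word (n + 1) q r"
  have "word n (q(n := False)) (r(n := False))"
    unfolding word_def
  proof (intro conjI allI impI notI)
    fix k assume "(q(n := False)) k \<or> (r(n := False)) k"
    then have "k \<noteq> n" "q k \<or> r k" by (auto split: if_splits)
    then have "1 \<le> k \<and> k < n + 1" using w unfolding word_def by blast
    then show "1 \<le> k" "k < n" using \<open>k \<noteq> n\<close> by auto
  next
    assume "\<exists>k l. 1 \<le> k \<and> k \<le> l \<and> l \<le> n - 2 \<and> (q(n := False)) k = (q(n := False)) (k + 1) \<and>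
      (r(n := False)) l = (r(n := False)) (l + 1)"
    then obtain k l where kl: "1 \<le> k" "k \<le> l" "l \<le> n - 2" "(q(n := False)) k = (q(n := False)) (k + 1)"
      "(r(n := False)) l = (r(n := False)) (l + 1)" by blast
    have ne: "k \<noteq> n" "k + 1 \<noteq> n" "l \<noteq> n" "l + 1 \<noteq> n" and l: "l \<le> n + 1 - 2" using kl(1-3) by linarith+
    have "q k = q (k + 1)" "r l = r (l + 1)" using kl(4,5) unfolding fun_upd_other[OF ne(1)] fun_upd_other[OF ne(2)]
      fun_upd_other[OF ne(3)] fun_upd_other[OF ne(4)] by simp_all
    then show False using w kl(1,2) l unfolding word_def by blast
  qed
  moreover have "r n \<noteq> r (n - 1) \<or> (\<forall>k. 1 \<le> k \<and> k < n \<longrightarrow> q k \<noteq> q (k + 1))"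
  proof (rule ccontr)
    assume "\<not> ?thesis"
    then obtain k where k: "1 \<le> k" "k < n" "q k = q (k + 1)" and r: "r (n - 1) = r n" by blast
    have "k \<le> n - 1" "n - 1 \<le> n + 1 - 2" "n - 1 + 1 = n" using k by simp_all
    then show False using w k(1,3) r unfolding word_def by metis
  qed
  ultimately show "word n (q(n := False)) (r(n := False)) \<and>
    (r n \<noteq> r (n - 1) \<or> (\<forall>k. 1 \<le> k \<and> k < n \<longrightarrow> q k \<noteq> q (k + 1)))" by blast
next
  assume a: "word n (q(n := False)) (r(n := False)) \<and>
    (r n \<noteq> r (n - 1) \<or> (\<forall>k. 1 \<le> k \<and> k < n \<longrightarrow> q k \<noteq> q (k + 1)))"
  then have w: "word n (q(n := False)) (r(n := False))" by blast
  show "word (n + 1) q r"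
    unfolding word_def
  proof (intro conjI allI impI notI)
    fix k assume k: "q k \<or> r k"
    have "k = n \<or> (1 \<le> k \<and> k < n)"
    proof (cases "k = n")
      case False
      then show ?thesis using w k unfolding word_def by fastforce
    qed simp
    then show "1 \<le> k" "k < n + 1" using assms by auto
  next
    assume "\<exists>k l. 1 \<le> k \<and> k \<le> l \<and> l \<le> n + 1 - 2 \<and> q k = q (k + 1) \<and> r l = r (l + 1)"
    then obtain k l where kl: "1 \<le> k" "k \<le> l" "l \<le> n - 1" "q k = q (k + 1)" "r l = r (l + 1)" by auto
    show False
    proof (cases "l = n - 1")
      case True
      then show False using kl a by auto
    next
      case False
      then have ne: "k \<noteq> n" "k + 1 \<noteq> n" "l \<noteq> n" "l + 1 \<noteq> n" and l: "l \<le> n - 2" using kl(1-3) by linarith+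
      have "(q(n := False)) k = (q(n := False)) (k + 1)" "(r(n := False)) l = (r(n := False)) (l + 1)"
        using kl(4,5) unfolding fun_upd_other[OF ne(1)] fun_upd_other[OF ne(2)]
        fun_upd_other[OF ne(3)] fun_upd_other[OF ne(4)] by simp_all
      then show False using w kl(1,2) l unfolding word_def by blast
    qed
  qed
qed


lemma fun_upd_cancel: "f(n := b) = g(n := c) \<Longrightarrow> f n = g n \<Longrightarrow> f = g"
  by (metis fun_upd_triv fun_upd_upd)

lemma fun_upd_False: "\<not> f n \<Longrightarrow> f(n := False) = f"
  by (simp add: fun_eq_iff)

lemma words_at_n: "(q, r) \<in> words n \<Longrightarrow> \<not> q n \<and> \<not> r n"
  unfolding words_def word_def by blast

definition extend :: "int \<Rightarrow> bool \<Rightarrow> (int \<Rightarrow> bool) \<times> (int \<Rightarrow> bool) \<Rightarrow> (int \<Rightarrow> bool) \<times> (int \<Rightarrow> bool)" where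
  "extend n b = (\<lambda>(q, r). (q(n := b), r(n := \<not> r (n - 1))))"

text \<open>Here \<open>q\<close> continues to alternate, and \<open>b\<close> records whether
  \<open>r\<close> repeats at the new place.\<close>

definition extend_alternating :: "int \<Rightarrow> bool \<Rightarrow> (int \<Rightarrow> bool) \<times> (int \<Rightarrow> bool) \<Rightarrow> (int \<Rightarrow> bool) \<times> (int \<Rightarrow> bool)" where
  "extend_alternating n b = (\<lambda>(q, r). (q(n := \<not> q (n - 1)), r(n := b = r (n - 1))))"

lemma inj_extend: "inj_on (extend n b) (words n)"
proof (rule inj_onI)
  fix u w assume u: "u \<in> words n" "w \<in> words n" "extend n b u = extend n b w"
  obtain q r q' r' where e: "u = (q, r)" "w = (q', r')" by fastforce
  have "q n = q' n" "r n = r' n" using u(1,2) words_at_n unfolding e by blast+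
  moreover have "q(n := b) = q'(n := b)" "r(n := \<not> r (n - 1)) = r'(n := \<not> r' (n - 1))"
    using u(3) unfolding e extend_def by simp_all
  ultimately show "u = w" unfolding e using fun_upd_cancel[of q n] fun_upd_cancel[of r n] by blast
qed

lemma inj_extend_alternating: "inj_on (extend_alternating n b) (words n)"
proof (rule inj_onI)
  fix u w assume u: "u \<in> words n" "w \<in> words n" "extend_alternating n b u = extend_alternating n b w"
  obtain q r q' r' where e: "u = (q, r)" "w = (q', r')" by fastforce
  have "q n = q' n" "r n = r' n" using u(1,2) words_at_n unfolding e by blast+
  moreover have "q(n := \<not> q (n - 1)) = q'(n := \<not> q' (n - 1))" "r(n := b = r (n - 1)) = r'(n := b = r' (n - 1))"
    using u(3) unfolding e extend_alternating_def by simp_all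
  ultimately show "u = w" unfolding e using fun_upd_cancel[of q n] fun_upd_cancel[of r n] by blast
qed

lemma alternating_words_subset: "alternating_words n \<subseteq> words n"
  unfolding alternating_words_def words_def by blast

lemma alternating_restrict:
  fixes n :: int
  assumes "n \<ge> 2"
  shows "(\<forall>k. 1 \<le> k \<and> k < n \<longrightarrow> q k \<noteq> q (k + 1)) \<longleftrightarrow>
    q n \<noteq> q (n - 1) \<and> (\<forall>k. 1 \<le> k \<and> k < n - 1 \<longrightarrow> (q(n := False)) k \<noteq> (q(n := False)) (k + 1))"
    (is "?L \<longleftrightarrow> ?a \<and> ?R")
proof -
  have eq: "(q(n := False)) k = q k \<and> (q(n := False)) (k + 1) = q (k + 1)" if "k < n - 1" for k
  proof -
    have "k \<noteq> n" "k + 1 \<noteq> n" using that by linarith+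
    then show ?thesis by simp
  qed
  have last: "1 \<le> n - 1" "n - 1 < n" "n - 1 + 1 = n" using assms by simp_all
  show ?thesis
  proof (intro iffI conjI allI impI)
    assume l: ?L
    then have "q (n - 1) \<noteq> q (n - 1 + 1)" using last(1,2) by blast
    then show ?a unfolding last(3) by blast
    fix k assume k: "1 \<le> k \<and> k < n - 1"
    then have "k < n" by simp
    then show "(q(n := False)) k \<noteq> (q(n := False)) (k + 1)" using eq[of k] l k by blast
  next
    fix k assume r: "?a \<and> ?R" and k: "1 \<le> k \<and> k < n"
    show "q k \<noteq> q (k + 1)"
    proof (cases "k = n - 1")
      case True
      then have "k + 1 = n" by simp
      then show ?thesis using r True by metis
    next
      case False
      then have "k < n - 1" using k by simp
      then show ?thesis using eq[of k] r k by blast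
    qed
  qed
qed

text \<open>If \<open>r\<close> does not repeat at the new place, the new bit of \<open>q\<close> is
  free. If it does, \<open>q\<close> must alternate all along, which fixes its new bit.\<close>

lemma words_Suc:
  assumes n: "n \<ge> 2"
  shows "words (n + 1) = extend n True ` words n \<union> extend n False ` words n \<union>
    extend_alternating n True ` alternating_words n"
proof (intro set_eqI iffI)
  fix w assume w: "w \<in> words (n + 1)"
  obtain q r where e: "w = (q, r)" by fastforce
  let ?w = "(q(n := False), r(n := False))"
  have s: "word n (q(n := False)) (r(n := False))" "r n \<noteq> r (n - 1) \<or> (\<forall>k. 1 \<le> k \<and> k < n \<longrightarrow> q k \<noteq> q (k + 1))"
    using w unfolding e words_def by (simp_all add: word_Suc[OF n])
  show "w \<in> extend n True ` words n \<union> extend n False ` words n \<union>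
    extend_alternating n True ` alternating_words n"
  proof (cases "r n = r (n - 1)")
    case False
    then have "w = extend n (q n) ?w" unfolding e extend_def by (auto simp: fun_eq_iff)
    then have "w \<in> extend n (q n) ` words n" using s(1) unfolding words_def by blast
    then show ?thesis by (cases "q n") simp_all
  next
    case True
    then have a: "\<forall>k. 1 \<le> k \<and> k < n \<longrightarrow> q k \<noteq> q (k + 1)" using s(2) by blast
    note a = a[unfolded alternating_restrict[OF n]]
    have "w = extend_alternating n True ?w" using True a unfolding e extend_alternating_def by (auto simp: fun_eq_iff)
    moreover have "?w \<in> alternating_words n" using a s(1) unfolding alternating_words_def by blast
    ultimately show ?thesis by blast
  qed
next
  fix w assume "w \<in> extend n True ` words n \<union> extend n False ` words n \<union>
    extend_alternating n True ` alternating_words n"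
  then consider b u where "u \<in> words n" "w = extend n b u"
    | u where "u \<in> alternating_words n" "w = extend_alternating n True u" by blast
  then show "w \<in> words (n + 1)"
  proof cases
    case 1
    obtain q r where e: "u = (q, r)" by fastforce
    have "\<not> q n" "\<not> r n" "word n q r" using 1(1) words_at_n unfolding e words_def by blast+
    moreover from this(1,2) have "q(n := False) = q" "r(n := False) = r" by (simp_all only: fun_upd_False not_False_eq_True)
    ultimately show ?thesis unfolding 1(2) e extend_def words_def by (simp add: word_Suc[OF n])
  next
    case 2
    obtain q r where e: "u = (q, r)" by fastforce
    have qr: "(q, r) \<in> words n" using 2(1) alternating_words_subset unfolding e by blast
    then have o: "\<not> q n" "\<not> r n" "word n q r" using words_at_n unfolding words_def by blast+
    have f: "q(n := False) = q" "r(n := False) = r" using o(1,2) by (simp_all only: fun_upd_False not_False_eq_True)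
    have "\<forall>k. 1 \<le> k \<and> k < n \<longrightarrow> (q(n := \<not> q (n - 1))) k \<noteq> (q(n := \<not> q (n - 1))) (k + 1)"
      unfolding alternating_restrict[OF n] using 2(1) f unfolding e alternating_words_def by simp
    then have "word (n + 1) (q(n := \<not> q (n - 1))) (r(n := True = r (n - 1)))"
      unfolding word_Suc[OF n] fun_upd_upd f using o(3) by blast
    then show ?thesis unfolding 2(2) e extend_alternating_def words_def by simp
  qed
qed

lemma alternating_words_Suc:
  assumes n: "n \<ge> 2"
  shows "alternating_words (n + 1) = extend_alternating n True ` alternating_words n \<union>
    extend_alternating n False ` alternating_words n"
proof (intro set_eqI iffI)
  fix w assume w: "w \<in> alternating_words (n + 1)"
  obtain q r where e: "w = (q, r)" by fastforce
  let ?w = "(q(n := False), r(n := False))"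
  have s: "word n (q(n := False)) (r(n := False))" "\<forall>k. 1 \<le> k \<and> k < n \<longrightarrow> q k \<noteq> q (k + 1)"
    using w unfolding e alternating_words_def by (simp_all add: word_Suc[OF n])
  note a = s(2)[unfolded alternating_restrict[OF n]]
  have "w = extend_alternating n (r n = r (n - 1)) ?w"
    using a unfolding e extend_alternating_def by (auto simp: fun_eq_iff)
  moreover have "?w \<in> alternating_words n" using a s(1) unfolding alternating_words_def by blast
  ultimately have "w \<in> extend_alternating n (r n = r (n - 1)) ` alternating_words n" by blast
  then show "w \<in> extend_alternating n True ` alternating_words n \<union> extend_alternating n False ` alternating_words n"
    by (cases "r n = r (n - 1)") simp_all
next
  fix w assume "w \<in> extend_alternating n True ` alternating_words n \<union> extend_alternating n False ` alternating_words n"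
  then obtain b u where u: "u \<in> alternating_words n" and w: "w = extend_alternating n b u" by blast
  obtain q r where e: "u = (q, r)" by fastforce
  have qr: "(q, r) \<in> words n" using u alternating_words_subset unfolding e by blast
  then have o: "\<not> q n" "\<not> r n" "word n q r" using words_at_n unfolding words_def by blast+
  have f: "q(n := False) = q" "r(n := False) = r" using o(1,2) by (simp_all only: fun_upd_False not_False_eq_True)
  have a: "\<forall>k. 1 \<le> k \<and> k < n \<longrightarrow> (q(n := \<not> q (n - 1))) k \<noteq> (q(n := \<not> q (n - 1))) (k + 1)"
    unfolding alternating_restrict[OF n] using u f unfolding e alternating_words_def by simp
  then have "word (n + 1) (q(n := \<not> q (n - 1))) (r(n := b = r (n - 1)))"
    unfolding word_Suc[OF n] fun_upd_upd f using o(3) by blast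
  moreover have "n + 1 - 1 = n" by simp
  ultimately show "w \<in> alternating_words (n + 1)" using a
    unfolding w e extend_alternating_def alternating_words_def mem_Collect_eq prod.case by metis
qed

lemma disjoint_images: "(\<And>u w. f u \<noteq> g w) \<Longrightarrow> f ` A \<inter> g ` B = {}"
  by blast

lemma card_alternating_words:
  assumes "n \<ge> 2" "finite (alternating_words n)"
  shows "card (alternating_words (n + 1)) = 2 * card (alternating_words n)" "finite (alternating_words (n + 1))"
proof -
  have inj: "inj_on (extend_alternating n b) (alternating_words n)" for b
    using inj_extend_alternating alternating_words_subset by (rule inj_on_subset)
  have same: "snd (extend_alternating n b u) n = (b = snd (extend_alternating n b u) (n - 1))" for b u
    by (simp add: extend_alternating_def split_beta)
  have "extend_alternating n True u \<noteq> extend_alternating n False w" for u w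
    using same[of True u] same[of False w] by metis
  then have "extend_alternating n True ` alternating_words n \<inter> extend_alternating n False ` alternating_words n = {}"
    by (rule disjoint_images)
  then show "card (alternating_words (n + 1)) = 2 * card (alternating_words n)"
    unfolding alternating_words_Suc[OF assms(1)] using assms(2)
    by (simp add: card_Un_disjoint card_image[OF inj])
  show "finite (alternating_words (n + 1))"
    unfolding alternating_words_Suc[OF assms(1)] using assms(2) by simp
qed

lemma card_words:
  assumes "n \<ge> 2" "finite (words n)"
  shows "card (words (n + 1)) = 2 * card (words n) + card (alternating_words n)" "finite (words (n + 1))"
proof -
  have fin: "finite (alternating_words n)" using alternating_words_subset assms(2) by (rule finite_subset)
  have inj: "inj_on (extend_alternating n True) (alternating_words n)"
    using inj_extend_alternating alternating_words_subset by (rule inj_on_subset)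
  have q: "fst (extend n b u) n = b" and r: "snd (extend n b u) n \<noteq> snd (extend n b u) (n - 1)" for b u
    by (simp_all add: extend_def split_beta)
  have r': "snd (extend_alternating n True u) n = snd (extend_alternating n True u) (n - 1)" for u
    by (simp add: extend_alternating_def split_beta)
  have "extend n True u \<noteq> extend n False w" for u w using q[of True u] q[of False w] by metis
  then have "extend n True ` words n \<inter> extend n False ` words n = {}" by (rule disjoint_images)
  moreover have "extend n b u \<noteq> extend_alternating n True w" for b u w using r[of b u] r'[of w] by metis
  then have "extend n b ` words n \<inter> extend_alternating n True ` alternating_words n = {}" for b
    by (rule disjoint_images)
  then have "(extend n True ` words n \<union> extend n False ` words n) \<inter> extend_alternating n True ` alternating_words n = {}"
    by (simp only: Int_Un_distrib2 Un_empty simp_thms)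
  ultimately show "card (words (n + 1)) = 2 * card (words n) + card (alternating_words n)"
    unfolding words_Suc[OF assms(1)] using assms(2) fin
    by (simp add: card_Un_disjoint card_image[OF inj] card_image[OF inj_extend])
  show "finite (words (n + 1))"
    unfolding words_Suc[OF assms(1)] using assms(2) fin by simp
qed

lemma words_2: "words 2 = (\<lambda>(a, b). (\<lambda>k. k = 1 \<and> a, \<lambda>k. k = 1 \<and> b)) ` UNIV"
proof (intro set_eqI iffI)
  fix w assume w: "w \<in> words 2"
  obtain q r where e: "w = (q, r)" by fastforce
  have "q k \<or> r k \<longrightarrow> k = 1" for k
  proof -
    have "q k \<or> r k \<longrightarrow> 1 \<le> k \<and> k < 2" using w unfolding e words_def word_def by blast
    then show ?thesis by auto
  qed
  then have "w = (\<lambda>(a, b). (\<lambda>k. k = 1 \<and> a, \<lambda>k. k = 1 \<and> b)) (q 1, r 1)"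
    unfolding e by (auto simp: fun_eq_iff)
  then show "w \<in> (\<lambda>(a, b). (\<lambda>k. k = 1 \<and> a, \<lambda>k. k = 1 \<and> b)) ` UNIV" by blast
qed (auto simp: words_def word_def)

lemma alternating_words_2: "alternating_words 2 = words 2"
  unfolding alternating_words_def words_def by auto

lemma card_words_2: "card (words 2) = 4" "finite (words 2)"
proof -
  have "inj (\<lambda>(a, b). (\<lambda>k :: int. k = 1 \<and> a, \<lambda>k :: int. k = 1 \<and> b))"
    by (rule injI) (auto simp: fun_eq_iff split: prod.splits)
  then show "card (words 2) = 4" unfolding words_2
    by (subst card_image) (simp_all add: card_UNIV_bool flip: UNIV_Times_UNIV)
  show "finite (words 2)" unfolding words_2 by simp
qed

lemma words_1: "words 1 = {(\<lambda>k. False, \<lambda>k. False)}"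
proof -
  have "q k = False \<and> r k = False" if "word 1 q r" for q r k
  proof -
    have "q k \<or> r k \<longrightarrow> 1 \<le> k \<and> k < 1" using that unfolding word_def by blast
    then show ?thesis by auto
  qed
  moreover have "word 1 (\<lambda>k. False) (\<lambda>k. False)" unfolding word_def by auto
  ultimately show ?thesis unfolding words_def by (auto simp: fun_eq_iff)
qed

text \<open>The induction carries along that \<open>2 ^ n\<close> words have alternating
  \<open>q\<close>. It starts at \<open>n = 2\<close> because an extension compares the new letter
  with the one at \<open>n - 1\<close>, which for \<open>n = 1\<close> would be a dummy.\<close>

lemma card_words_eq: "n \<ge> 1 \<Longrightarrow> card (words (int n)) = n * 2 ^ (n - 1)"
proof -
  have "card (words (int k + 2)) = (k + 2) * 2 ^ (k + 1) \<and> finite (words (int k + 2)) \<and>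
    card (alternating_words (int k + 2)) = 2 ^ (k + 2) \<and> finite (alternating_words (int k + 2))" for k
  proof (induction k)
    case 0
    then show ?case using card_words_2 alternating_words_2 by simp
  next
    case (Suc k)
    have e: "int (Suc k) + 2 = (int k + 2) + 1" by simp
    show ?case unfolding e
      using card_words[of "int k + 2"] card_alternating_words[of "int k + 2"] Suc.IH by simp
  qed
  from this[of "n - 2"] show "card (words (int n)) = n * 2 ^ (n - 1)" if "n \<ge> 1"
    using that words_1 by (cases "n = 1") (auto simp: of_nat_diff Suc_diff_Suc numeral_2_eq_2)
qed

subsection \<open>Tilings as sets of tiles\<close>

lemma dimer_eq_iff [simp]:
  "hdimer a = hdimer b \<longleftrightarrow> a = b" "vdimer a = vdimer b \<longleftrightarrow> a = b" "monomer a = monomer b \<longleftrightarrow> a = b"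
  "hdimer a \<noteq> vdimer b" "vdimer b \<noteq> hdimer a" "hdimer a \<noteq> monomer b" "monomer b \<noteq> hdimer a"
  "vdimer a \<noteq> monomer b" "monomer b \<noteq> vdimer a"
  by (cases a; cases b; auto simp: hdimer_def vdimer_def monomer_def doubleton_eq_iff)+

lemma card_tile [simp]: "card (hdimer a) = 2" "card (vdimer a) = 2" "card (monomer a) = 1"
  by (cases a; simp add: hdimer_def vdimer_def monomer_def)+

lemma mem_hdimer: "(i, j) \<in> hdimer (a, b) \<longleftrightarrow> i = a \<and> (j = b \<or> j = Suc b)"
  and mem_vdimer: "(i, j) \<in> vdimer (a, b) \<longleftrightarrow> j = b \<and> (i = a \<or> i = Suc a)"
  and mem_monomer: "(i, j) \<in> monomer (a, b) \<longleftrightarrow> i = a \<and> j = b"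
  by (auto simp: hdimer_def vdimer_def monomer_def)

definition tile_h :: "(nat \<times> nat) set set \<Rightarrow> int \<Rightarrow> int \<Rightarrow> bool" where
  "tile_h P i j \<longleftrightarrow> 0 \<le> i \<and> 0 \<le> j \<and> hdimer (nat i, nat j) \<in> P"

definition tile_v :: "(nat \<times> nat) set set \<Rightarrow> int \<Rightarrow> int \<Rightarrow> bool" where
  "tile_v P i j \<longleftrightarrow> 0 \<le> i \<and> 0 \<le> j \<and> vdimer (nat i, nat j) \<in> P"

definition tiling_of :: "(int \<Rightarrow> int \<Rightarrow> bool) \<Rightarrow> (int \<Rightarrow> int \<Rightarrow> bool) \<Rightarrow> (int \<Rightarrow> int \<Rightarrow> bool) \<Rightarrow> (nat \<times> nat) set set" where
  "tiling_of h v u = {t. \<exists>a b. t = hdimer (a, b) \<and> h (int a) (int b) \<or> t = vdimer (a, b) \<and> v (int a) (int b) \<or>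
     t = monomer (a, b) \<and> u (int a) (int b)}"

lemma tiling_of_mem:
  "hdimer (a, b) \<in> tiling_of h v u \<longleftrightarrow> h (int a) (int b)"
  "vdimer (a, b) \<in> tiling_of h v u \<longleftrightarrow> v (int a) (int b)"
  "monomer (a, b) \<in> tiling_of h v u \<longleftrightarrow> u (int a) (int b)"
  unfolding tiling_of_def by auto

lemma nat_Suc_int: "0 \<le> i \<Longrightarrow> nat (i + 1) = Suc (nat i)"
  by simp

section \<open>From a tatami tiling to its dimers\<close>

context
  fixes n :: nat and P :: "(nat \<times> nat) set set"
  assumes P: "is_tatami n n P" and n: "n \<ge> 1"
begin

lemma tiles_subset: "P \<subseteq> tiles n n"
  and unique_tile: "c \<in> grid n n \<Longrightarrow> \<exists>!t. t \<in> P \<and> c \<in> t"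
proof -
  have t: "is_tiling n n P" using P unfolding is_tatami_def by (rule conjunct1)
  show "P \<subseteq> tiles n n" using t unfolding is_tiling_def by (rule conjunct1)
  show "\<exists>!t. t \<in> P \<and> c \<in> t" if "c \<in> grid n n"
    using t that unfolding is_tiling_def by (simp only: Ball_def)
qed

lemma tile_cases:
  assumes "t \<in> P"
  obtains a b where "t = hdimer (a, b)" "a < n" "Suc b < n"
    | a b where "t = vdimer (a, b)" "Suc a < n" "b < n"
    | a b where "t = monomer (a, b)" "a < n" "b < n"
  using subsetD[OF tiles_subset assms] unfolding tiles_def
  by (auto simp: grid_def hdimer_def vdimer_def monomer_def subset_iff)

lemma tile_unique:
  assumes "t \<in> P" "t' \<in> P" "c \<in> t" "c \<in> t'"
  shows "t = t'"
proof -
  have "c \<in> grid n n" using subsetD[OF tiles_subset assms(1)] assms(3) unfolding tiles_def by blast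
  from unique_tile[OF this] show ?thesis using assms by auto
qed

lemma tile_exists:
  assumes "i < n" "j < n"
  shows "\<exists>t\<in>P. (i, j) \<in> t"
  using unique_tile[of "(i, j)"] assms unfolding grid_def by auto

lemma dimer_bounds:
  "hdimer (a, b) \<in> P \<Longrightarrow> a < n \<and> Suc b < n" "vdimer (a, b) \<in> P \<Longrightarrow> Suc a < n \<and> b < n"
  "monomer (a, b) \<in> P \<Longrightarrow> a < n \<and> b < n"
  by (erule tile_cases; simp)+

lemma tile_h_in: "tile_h P i j \<Longrightarrow> 0 \<le> i \<and> i < int n \<and> 0 \<le> j \<and> j + 1 < int n"
  using dimer_bounds(1)[of "nat i" "nat j"] unfolding tile_h_def by auto

lemma tile_v_in: "tile_v P i j \<Longrightarrow> 0 \<le> i \<and> i + 1 < int n \<and> 0 \<le> j \<and> j < int n"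
  using dimer_bounds(2)[of "nat i" "nat j"] unfolding tile_v_def by auto

lemma two_cells:
  assumes "t \<in> P"
  shows "(i, j) \<in> t \<Longrightarrow> (i, Suc j) \<in> t \<Longrightarrow> t = hdimer (i, j)"
    "(i, j) \<in> t \<Longrightarrow> (Suc i, j) \<in> t \<Longrightarrow> t = vdimer (i, j)"
    "(i, j) \<in> t \<Longrightarrow> (Suc i, Suc j) \<notin> t"
    "(i, Suc j) \<in> t \<Longrightarrow> (Suc i, j) \<notin> t"
  by (rule tile_cases[OF assms]; auto simp: mem_hdimer mem_vdimer mem_monomer)+

text \<open>Coverage of an interior point is the tatami condition: two of the four cells around it
  share a tile, and these cannot be diagonal neighbours, so they form a dimer with the point at the
  middle of a long side.\<close>

lemma tatami_tiles: "tatami (int n) (tile_h P) (tile_v P)"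
proof
  show "int n \<ge> 1" using n by simp
  show "0 \<le> i \<and> i < int n \<and> 0 \<le> j \<and> j + 1 < int n" if "tile_h P i j" for i j
    using that by (rule tile_h_in)
  show "0 \<le> i \<and> i + 1 < int n \<and> 0 \<le> j \<and> j < int n" if "tile_v P i j" for i j
    using that by (rule tile_v_in)
  show "\<not> tile_h P i (j + 1)" if "tile_h P i j" for i j
  proof
    assume "tile_h P i (j + 1)"
    then have "hdimer (nat i, nat j) = hdimer (nat i, Suc (nat j))"
      using that by (intro tile_unique[of _ _ "(nat i, Suc (nat j))"]) (auto simp: tile_h_def nat_Suc_int mem_hdimer)
    then show False by simp
  qed
  show "\<not> tile_v P (i + 1) j" if "tile_v P i j" for i j
  proof
    assume "tile_v P (i + 1) j"
    then have "vdimer (nat i, nat j) = vdimer (Suc (nat i), nat j)"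
      using that by (intro tile_unique[of _ _ "(Suc (nat i), nat j)"]) (auto simp: tile_v_def nat_Suc_int mem_vdimer)
    then show False by simp
  qed
  have no_meet: "vdimer b \<notin> P" if "c \<in> hdimer a" "hdimer a \<in> P" "c \<in> vdimer b" for a b c
    using tile_unique[OF that(2) _ that(1,3)] by auto
  show "\<not> tile_v P i j \<and> \<not> tile_v P i (j + 1) \<and> \<not> tile_v P (i - 1) j \<and> \<not> tile_v P (i - 1) (j + 1)"
    if h: "tile_h P i j" for i j
  proof -
    have P: "hdimer (nat i, nat j) \<in> P" "0 \<le> i" "0 \<le> j" using h by (auto simp: tile_h_def)
    have mem: "(nat i, nat j) \<in> hdimer (nat i, nat j)" "(nat i, Suc (nat j)) \<in> hdimer (nat i, nat j)"
      by (auto simp: mem_hdimer)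
    have i: "nat i = Suc (nat (i - 1))" if "0 \<le> i - 1" using that by simp
    have "\<not> tile_v P i j"
      using no_meet[OF mem(1) P(1), of "(nat i, nat j)"] by (simp add: tile_v_def mem_vdimer)
    moreover have "\<not> tile_v P i (j + 1)"
      using no_meet[OF mem(2) P(1), of "(nat i, nat (j + 1))"] P(2,3)
      by (simp add: tile_v_def mem_vdimer nat_Suc_int)
    moreover have "\<not> tile_v P (i - 1) j"
      using no_meet[OF mem(1) P(1), of "(nat (i - 1), nat j)"] i by (auto simp: tile_v_def mem_vdimer)
    moreover have "\<not> tile_v P (i - 1) (j + 1)"
      using no_meet[OF mem(2) P(1), of "(nat (i - 1), nat (j + 1))"] P(3) i
      by (auto simp: tile_v_def mem_vdimer nat_Suc_int)
    ultimately show ?thesis by blast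
  qed
  show "tile_h P (i - 1) (j - 1) \<or> tile_h P i (j - 1) \<or> tile_v P (i - 1) (j - 1) \<or> tile_v P (i - 1) j"
    if ij: "0 < i" "i < int n" "0 < j" "j < int n" for i j
  proof -
    define a b where "a = nat (i - 1)" and "b = nat (j - 1)"
    have eq: "nat (i - 1) = a" "nat (j - 1) = b" "nat i = Suc a" "nat j = Suc b" using ij by (auto simp: a_def b_def)
    have ab: "Suc a < n" "Suc b < n" using ij by (auto simp: a_def b_def)
    have ab': "a < n" "b < n" using ab by simp_all
    obtain t1 where t1: "t1 \<in> P" "(a, b) \<in> t1" using tile_exists[OF ab'] by blast
    obtain t2 where t2: "t2 \<in> P" "(a, Suc b) \<in> t2" using tile_exists[OF ab'(1) ab(2)] by blast
    obtain t3 where t3: "t3 \<in> P" "(Suc a, b) \<in> t3" using tile_exists[OF ab(1) ab'(2)] by blast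
    obtain t4 where t4: "t4 \<in> P" "(Suc a, Suc b) \<in> t4" using tile_exists[OF ab] by blast
    note t = t1(1) t2(1) t3(1) t4(1) and mem = t1(2) t2(2) t3(2) t4(2)
    have "\<not> (t1 \<noteq> t2 \<and> t1 \<noteq> t3 \<and> t1 \<noteq> t4 \<and> t2 \<noteq> t3 \<and> t2 \<noteq> t4 \<and> t3 \<noteq> t4)"
    proof
      assume d: "t1 \<noteq> t2 \<and> t1 \<noteq> t3 \<and> t1 \<noteq> t4 \<and> t2 \<noteq> t3 \<and> t2 \<noteq> t4 \<and> t3 \<noteq> t4"
      from P have "\<forall>i j. 0 < i \<and> i < n \<and> 0 < j \<and> j < n \<longrightarrow>
        \<not> (\<exists>t1\<in>P. \<exists>t2\<in>P. \<exists>t3\<in>P. \<exists>t4\<in>P.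
              (i - 1, j - 1) \<in> t1 \<and> (i - 1, j) \<in> t2 \<and> (i, j - 1) \<in> t3 \<and> (i, j) \<in> t4 \<and>
              t1 \<noteq> t2 \<and> t1 \<noteq> t3 \<and> t1 \<noteq> t4 \<and> t2 \<noteq> t3 \<and> t2 \<noteq> t4 \<and> t3 \<noteq> t4)"
        unfolding is_tatami_def by (rule conjunct2)
      from this[rule_format, of "Suc a" "Suc b", unfolded diff_Suc_1] show False
        using ab t mem d by blast
    qed
    then consider "t1 = t2" | "t1 = t3" | "t1 = t4" | "t2 = t3" | "t2 = t4" | "t3 = t4" by blast
    then have "hdimer (a, b) \<in> P \<or> hdimer (Suc a, b) \<in> P \<or> vdimer (a, b) \<in> P \<or> vdimer (a, Suc b) \<in> P"
    proof cases
      case 1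
      then show ?thesis using two_cells(1)[OF t(1) mem(1)] t(1) mem(2) by simp
    next
      case 2
      then show ?thesis using two_cells(2)[OF t(1) mem(1)] t(1) mem(3) by simp
    next
      case 3
      then show ?thesis using two_cells(3)[OF t(1) mem(1)] mem(4) by simp
    next
      case 4
      then show ?thesis using two_cells(4)[OF t(2) mem(2)] mem(3) by simp
    next
      case 5
      then show ?thesis using two_cells(2)[OF t(2) mem(2)] t(2) mem(4) by simp
    next
      case 6
      then show ?thesis using two_cells(1)[OF t(3) mem(3)] t(3) mem(4) by simp
    qed
    then show ?thesis using ij by (auto simp: tile_h_def tile_v_def eq)
  qed
qed

lemma uncovered_tiles:
  "tatami.uncovered (int n) (tile_h P) (tile_v P) (int a) (int b) \<longleftrightarrow> monomer (a, b) \<in> P"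
proof
  assume u: "tatami.uncovered (int n) (tile_h P) (tile_v P) (int a) (int b)"
  note u = u[unfolded tatami.uncovered_def[OF tatami_tiles]]
  then obtain t where t: "t \<in> P" "(a, b) \<in> t" using tile_exists[of a b] by auto
  from t(1) show "monomer (a, b) \<in> P"
  proof (cases rule: tile_cases)
    case (1 i j)
    then have "i = a" "j = b \<or> b = Suc j" using t(2) by (auto simp: mem_hdimer)
    then show ?thesis using u t(1) 1 by (auto simp: tile_h_def)
  next
    case (2 i j)
    then have "j = b" "i = a \<or> a = Suc i" using t(2) by (auto simp: mem_vdimer)
    then show ?thesis using u t(1) 2 by (auto simp: tile_v_def)
  next
    case (3 i j)
    then show ?thesis using t by (auto simp: mem_monomer)
  qed
next
  assume m: "monomer (a, b) \<in> P"
  then have ab: "a < n" "b < n" using dimer_bounds(3) by blast+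
  have no: "t = monomer (a, b)" if "t \<in> P" "(a, b) \<in> t" for t
    using tile_unique[OF that(1) m that(2)] by (simp add: mem_monomer)
  have "\<not> tile_h P (int a) (int b)" using no[of "hdimer (a, b)"] by (auto simp: tile_h_def mem_hdimer)
  moreover have "\<not> tile_v P (int a) (int b)" using no[of "vdimer (a, b)"] by (auto simp: tile_v_def mem_vdimer)
  moreover have "\<not> tile_h P (int a) (int b - 1)"
    using no[of "hdimer (a, b - 1)"] by (cases b) (auto simp: tile_h_def mem_hdimer)
  moreover have "\<not> tile_v P (int a - 1) (int b)"
    using no[of "vdimer (a - 1, b)"] by (cases a) (auto simp: tile_v_def mem_vdimer)
  ultimately show "tatami.uncovered (int n) (tile_h P) (tile_v P) (int a) (int b)"
    unfolding tatami.uncovered_def[OF tatami_tiles] using ab by simp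
qed

lemma tiling_of_tiles: "tiling_of (tile_h P) (tile_v P) (tatami.uncovered (int n) (tile_h P) (tile_v P)) = P"
proof (intro set_eqI iffI)
  fix t assume "t \<in> P"
  then show "t \<in> tiling_of (tile_h P) (tile_v P) (tatami.uncovered (int n) (tile_h P) (tile_v P))"
    by (cases rule: tile_cases) (use \<open>t \<in> P\<close> in \<open>auto simp: tiling_of_mem uncovered_tiles tile_h_def tile_v_def\<close>)
next
  fix t assume "t \<in> tiling_of (tile_h P) (tile_v P) (tatami.uncovered (int n) (tile_h P) (tile_v P))"
  then show "t \<in> P" unfolding tiling_of_def by (auto simp: uncovered_tiles tile_h_def tile_v_def)
qed

lemma num_monomers_tiles:
  "num_monomers P = card {(i, j). tatami.uncovered (int n) (tile_h P) (tile_v P) i j}"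
proof -
  define U where "U = {(i, j). tatami.uncovered (int n) (tile_h P) (tile_v P) i j}"
  have U: "(i, j) \<in> U \<longleftrightarrow> 0 \<le> i \<and> 0 \<le> j \<and> monomer (nat i, nat j) \<in> P" for i j
  proof (cases "0 \<le> i \<and> 0 \<le> j")
    case True
    then show ?thesis using uncovered_tiles[of "nat i" "nat j"] by (simp add: U_def)
  next
    case False
    then show ?thesis by (auto simp: U_def tatami.uncovered_def[OF tatami_tiles])
  qed
  define f where "f = (\<lambda>(i, j). monomer (nat i, nat j))"
  have "inj_on f U"
  proof (rule inj_onI)
    fix c d assume c: "c \<in> U" and d: "d \<in> U" and eq: "f c = f d"
    obtain i j a b where cd: "c = (i, j)" "d = (a, b)" by fastforce
    have "nat i = nat a" "nat j = nat b" using eq by (simp_all add: f_def cd)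
    then show "c = d" using c d by (simp add: cd U eq_nat_nat_iff)
  qed
  moreover have "f ` U = {t \<in> P. card t = 1}"
  proof (intro set_eqI iffI)
    fix t assume "t \<in> f ` U"
    then obtain c where c: "t = f c" "c \<in> U" by (rule imageE)
    obtain i j where ij: "c = (i, j)" by fastforce
    show "t \<in> {t \<in> P. card t = 1}" using c by (simp add: ij U f_def)
  next
    fix t assume t: "t \<in> {t \<in> P. card t = 1}"
    then have "t \<in> P" by simp
    then show "t \<in> f ` U"
    proof (cases rule: tile_cases)
      case (3 a b)
      then have "(int a, int b) \<in> U" using \<open>t \<in> P\<close> by (simp add: U)
      then have "f (int a, int b) \<in> f ` U" by (rule imageI)
      then show ?thesis using 3 by (simp add: f_def)
    qed (use t in simp_all)
  qed
  ultimately have "card {t \<in> P. card t = 1} = card U" by (metis card_image)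
  then show ?thesis unfolding num_monomers_def U_def .
qed

end

text \<open>An elimination rule listing the five possible tiles on a given cell. The positivity
  premises make the subtractions on \<open>nat\<close> genuine.\<close>

lemma tiling_of_at:
  assumes u: "u (int i) (int j) \<Longrightarrow> t = monomer (i, j) \<Longrightarrow> R"
    and h: "h (int i) (int j) \<Longrightarrow> t = hdimer (i, j) \<Longrightarrow> R"
    and h': "h (int i) (int j - 1) \<Longrightarrow> j > 0 \<Longrightarrow> t = hdimer (i, j - 1) \<Longrightarrow> R"
    and v: "v (int i) (int j) \<Longrightarrow> t = vdimer (i, j) \<Longrightarrow> R"
    and v': "v (int i - 1) (int j) \<Longrightarrow> i > 0 \<Longrightarrow> t = vdimer (i - 1, j) \<Longrightarrow> R"
    and t: "t \<in> tiling_of h v u" "(i, j) \<in> t"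
  shows R
proof -
  from t(1) obtain a b where "t = hdimer (a, b) \<and> h (int a) (int b) \<or> t = vdimer (a, b) \<and> v (int a) (int b) \<or>
     t = monomer (a, b) \<and> u (int a) (int b)" unfolding tiling_of_def by blast
  then consider "t = hdimer (a, b)" "h (int a) (int b)" | "t = vdimer (a, b)" "v (int a) (int b)"
    | "t = monomer (a, b)" "u (int a) (int b)" by blast
  then show R
  proof cases
    case 1
    then have "i = a \<and> (j = b \<or> j = Suc b)" using t(2) by (simp add: mem_hdimer)
    then consider "i = a" "j = b" | "i = a" "j = Suc b" by blast
    then show R
    proof cases
      assume "i = a" "j = b"
      then show R using h 1 by blast
    next
      assume "i = a" "j = Suc b"
      then have "h (int i) (int j - 1)" "j > 0" "t = hdimer (i, j - 1)" using 1 by simp_all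
      then show R by (rule h')
    qed
  next
    case 2
    then have "j = b \<and> (i = a \<or> i = Suc a)" using t(2) by (simp add: mem_vdimer)
    then consider "j = b" "i = a" | "j = b" "i = Suc a" by blast
    then show R
    proof cases
      assume "j = b" "i = a"
      then show R using v 2 by blast
    next
      assume "j = b" "i = Suc a"
      then have "v (int i - 1) (int j)" "i > 0" "t = vdimer (i - 1, j)" using 2 by simp_all
      then show R by (rule v')
    qed
  next
    case 3
    then have "i = a" "j = b" using t(2) by (simp_all add: mem_monomer)
    then show R using u 3 by blast
  qed
qed

section \<open>From dimers back to a tatami tiling\<close>

context
  fixes n :: nat and h v :: "int \<Rightarrow> int \<Rightarrow> bool"
  assumes hv: "tatami (int n) h v"
begin

interpretation tatami "int n" h v by (fact hv)

lemma tile_h_tiling_of: "tile_h (tiling_of h v u) = h"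
  using h_in by (intro ext) (auto simp: tile_h_def tiling_of_mem)

lemma tile_v_tiling_of: "tile_v (tiling_of h v u) = v"
  using v_in by (intro ext) (auto simp: tile_v_def tiling_of_mem)

lemma tiling_of_unique:
  assumes "i < n" "j < n"
  shows "\<exists>!t. t \<in> tiling_of h v uncovered \<and> (i, j) \<in> t"
proof -
  have ij: "0 \<le> int i" "int i < int n" "0 \<le> int j" "int j < int n" using assms by simp_all
  note cases = cell_cases[OF ij]
  consider "h (int i) (int j)" | "h (int i) (int j - 1)" | "v (int i) (int j)" | "v (int i - 1) (int j)" | "uncovered (int i) (int j)"
    using cases by blast
  then show ?thesis
  proof cases
    case 1
    show ?thesis
    proof (rule ex1I[of _ "hdimer (i, j)"])
      show "hdimer (i, j) \<in> tiling_of h v uncovered \<and> (i, j) \<in> hdimer (i, j)"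
        using 1 by (simp add: tiling_of_mem mem_hdimer)
      show "t = hdimer (i, j)" if "t \<in> tiling_of h v uncovered \<and> (i, j) \<in> t" for t
        by (rule tiling_of_at[OF _ _ _ _ _ conjunct1[OF that] conjunct2[OF that]]) (use cases 1 in blast)+
    qed
  next
    case 2
    then have "j > 0" using h_in by fastforce
    show ?thesis
    proof (rule ex1I[of _ "hdimer (i, j - 1)"])
      show "hdimer (i, j - 1) \<in> tiling_of h v uncovered \<and> (i, j) \<in> hdimer (i, j - 1)"
        using 2 \<open>j > 0\<close> by (simp add: tiling_of_mem mem_hdimer of_nat_diff)
      show "t = hdimer (i, j - 1)" if "t \<in> tiling_of h v uncovered \<and> (i, j) \<in> t" for t
        by (rule tiling_of_at[OF _ _ _ _ _ conjunct1[OF that] conjunct2[OF that]]) (use cases 2 in blast)+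
    qed
  next
    case 3
    show ?thesis
    proof (rule ex1I[of _ "vdimer (i, j)"])
      show "vdimer (i, j) \<in> tiling_of h v uncovered \<and> (i, j) \<in> vdimer (i, j)"
        using 3 by (simp add: tiling_of_mem mem_vdimer)
      show "t = vdimer (i, j)" if "t \<in> tiling_of h v uncovered \<and> (i, j) \<in> t" for t
        by (rule tiling_of_at[OF _ _ _ _ _ conjunct1[OF that] conjunct2[OF that]]) (use cases 3 in blast)+
    qed
  next
    case 4
    then have "i > 0" using v_in by fastforce
    show ?thesis
    proof (rule ex1I[of _ "vdimer (i - 1, j)"])
      show "vdimer (i - 1, j) \<in> tiling_of h v uncovered \<and> (i, j) \<in> vdimer (i - 1, j)"
        using 4 \<open>i > 0\<close> by (simp add: tiling_of_mem mem_vdimer of_nat_diff)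
      show "t = vdimer (i - 1, j)" if "t \<in> tiling_of h v uncovered \<and> (i, j) \<in> t" for t
        by (rule tiling_of_at[OF _ _ _ _ _ conjunct1[OF that] conjunct2[OF that]]) (use cases 4 in blast)+
    qed
  next
    case 5
    show ?thesis
    proof (rule ex1I[of _ "monomer (i, j)"])
      show "monomer (i, j) \<in> tiling_of h v uncovered \<and> (i, j) \<in> monomer (i, j)"
        using 5 by (simp add: tiling_of_mem mem_monomer)
      show "t = monomer (i, j)" if "t \<in> tiling_of h v uncovered \<and> (i, j) \<in> t" for t
        by (rule tiling_of_at[OF _ _ _ _ _ conjunct1[OF that] conjunct2[OF that]]) (use cases 5 in blast)+
    qed
  qed
qed

text \<open>The dimer that covers an interior point contains two of the four cells around it, so the
  tiles on these cells cannot be four distinct ones.\<close>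

lemma is_tatami_tiling_of: "is_tatami n n (tiling_of h v uncovered)" (is "is_tatami n n ?P")
  unfolding is_tatami_def
proof (intro conjI allI impI)
  show "is_tiling n n ?P"
    unfolding is_tiling_def
  proof (intro conjI ballI)
    show "?P \<subseteq> tiles n n"
    proof
      fix t assume "t \<in> ?P"
      then obtain a b where "t = hdimer (a, b) \<and> h (int a) (int b) \<or> t = vdimer (a, b) \<and> v (int a) (int b) \<or>
        t = monomer (a, b) \<and> uncovered (int a) (int b)" unfolding tiling_of_def by blast
      then show "t \<in> tiles n n"
        using h_in[of "int a" "int b"] v_in[of "int a" "int b"]
        unfolding tiles_def grid_def uncovered_def
        by (auto simp: hdimer_def vdimer_def monomer_def)
    qed
  next
    fix c assume "c \<in> grid n n"
    then obtain i j where "c = (i, j)" "i < n" "j < n" unfolding grid_def by blast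
    then show "\<exists>!t. t \<in> ?P \<and> c \<in> t" using tiling_of_unique by simp
  qed
next
  fix i j assume ij: "0 < i \<and> i < n \<and> 0 < j \<and> j < n"
  obtain a b where ab: "i = Suc a" "j = Suc b" using ij by (metis gr0_implies_Suc)
  have lt: "a < n" "b < n" "Suc a < n" "Suc b < n" using ij ab by simp_all
  have same: "t = t'" if "t \<in> ?P" "t' \<in> ?P" "(k, l) \<in> t" "(k, l) \<in> t'" "k < n" "l < n" for t t' k l
    using tiling_of_unique[OF that(5,6)] that(1-4) by auto
  have "h (int a) (int b) \<or> h (int (Suc a)) (int b) \<or> v (int a) (int b) \<or> v (int a) (int (Suc b))"
    using vertex_covered[of "int i" "int j"] lt by (simp add: ab)
  then have cov: "hdimer (a, b) \<in> ?P \<or> hdimer (Suc a, b) \<in> ?P \<or> vdimer (a, b) \<in> ?P \<or> vdimer (a, Suc b) \<in> ?P"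
    unfolding tiling_of_mem .
  have no: False if t: "t1 \<in> ?P" "t2 \<in> ?P" "t3 \<in> ?P" "t4 \<in> ?P"
    and mem: "(a, b) \<in> t1" "(a, Suc b) \<in> t2" "(Suc a, b) \<in> t3" "(Suc a, Suc b) \<in> t4"
    and ne: "t1 \<noteq> t2" "t1 \<noteq> t3" "t2 \<noteq> t4" "t3 \<noteq> t4" for t1 t2 t3 t4
  proof -
    from cov consider "hdimer (a, b) \<in> ?P" | "hdimer (Suc a, b) \<in> ?P" | "vdimer (a, b) \<in> ?P" | "vdimer (a, Suc b) \<in> ?P"
      by (elim disjE)
    then show False
    proof cases
      case 1
      have "t1 = hdimer (a, b)" "t2 = hdimer (a, b)"
        using same[OF t(1) 1 mem(1)] same[OF t(2) 1 mem(2)] lt by (simp_all add: mem_hdimer)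
      then show False using ne by simp
    next
      case 2
      have "t3 = hdimer (Suc a, b)" "t4 = hdimer (Suc a, b)"
        using same[OF t(3) 2 mem(3)] same[OF t(4) 2 mem(4)] lt by (simp_all add: mem_hdimer)
      then show False using ne by simp
    next
      case 3
      have "t1 = vdimer (a, b)" "t3 = vdimer (a, b)"
        using same[OF t(1) 3 mem(1)] same[OF t(3) 3 mem(3)] lt by (simp_all add: mem_vdimer)
      then show False using ne by simp
    next
      case 4
      have "t2 = vdimer (a, Suc b)" "t4 = vdimer (a, Suc b)"
        using same[OF t(2) 4 mem(2)] same[OF t(4) 4 mem(4)] lt by (simp_all add: mem_vdimer)
      then show False using ne by simp
    qed
  qed
  show "\<not> (\<exists>t1\<in>?P. \<exists>t2\<in>?P. \<exists>t3\<in>?P. \<exists>t4\<in>?P.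
              (i - 1, j - 1) \<in> t1 \<and> (i - 1, j) \<in> t2 \<and> (i, j - 1) \<in> t3 \<and> (i, j) \<in> t4 \<and>
              t1 \<noteq> t2 \<and> t1 \<noteq> t3 \<and> t1 \<noteq> t4 \<and> t2 \<noteq> t3 \<and> t2 \<noteq> t4 \<and> t3 \<noteq> t4)"
    unfolding ab diff_Suc_1 by (intro notI, elim bexE conjE) (rule no)
qed

end

section \<open>The bijection between words and tilings\<close>

theorem theorem2:
  fixes n :: nat
  assumes "n \<ge> 1"
  shows "T n n n = n * 2 ^ (n - 1)"
proof -
  have n: "int n \<ge> 1" using assms by simp
  define F where "F = (\<lambda>(q, r). tiling_of (word_h (int n) q r) (word_v (int n) q r)
    (tatami.uncovered (int n) (word_h (int n) q r) (word_v (int n) q r)))"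
  have tiles: "tile_h (F (q, r)) = word_h (int n) q r" "tile_v (F (q, r)) = word_v (int n) q r"
    and F: "is_tatami n n (F (q, r))" "num_monomers (F (q, r)) = n"
    if w: "word (int n) q r" for q r
  proof -
    note t = tatami_word[OF w n]
    show h: "tile_h (F (q, r)) = word_h (int n) q r" and v: "tile_v (F (q, r)) = word_v (int n) q r"
      unfolding F_def prod.case by (rule tile_h_tiling_of[OF t], rule tile_v_tiling_of[OF t])
    show tatami: "is_tatami n n (F (q, r))"
      unfolding F_def prod.case by (rule is_tatami_tiling_of[OF t])
    show "num_monomers (F (q, r)) = n"
      unfolding num_monomers_tiles[OF tatami assms] h v
      using max_tatami.card_uncovered[OF max_tatami_word[OF w n]] by simp
  qed
  have "inj_on F (words (int n))"
  proof (rule inj_onI)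
    fix u w assume u: "u \<in> words (int n)" and w: "w \<in> words (int n)" and eq: "F u = F w"
    obtain q r q' r' where e: "u = (q, r)" "w = (q', r')" by fastforce
    have qr: "word (int n) q r" "word (int n) q' r'" using u w unfolding e words_def by simp_all
    have "word_h (int n) q r = word_h (int n) q' r'" "word_v (int n) q r = word_v (int n) q' r'"
      using tiles[OF qr(1)] tiles[OF qr(2)] eq unfolding e by simp_all
    from word_eq_if_dimers_eq[OF qr n this] show "u = w" unfolding e by simp
  qed
  moreover have "F ` words (int n) = {P. is_tatami n n P \<and> num_monomers P = n}"
  proof (intro set_eqI iffI)
    fix P assume "P \<in> F ` words (int n)"
    then obtain w where w: "P = F w" "w \<in> words (int n)" by (rule imageE)
    obtain q r where e: "w = (q, r)" by fastforce
    have "word (int n) q r" using w(2) unfolding e words_def by simp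
    from F[OF this] show "P \<in> {P. is_tatami n n P \<and> num_monomers P = n}" unfolding w(1) e by simp
  next
    fix P assume "P \<in> {P. is_tatami n n P \<and> num_monomers P = n}"
    then have P: "is_tatami n n P" "num_monomers P = n" by simp_all
    \<comment> \<open>Having \<open>n\<close> monomers makes the rigidity results available, so the
      bits read off the bounces of \<open>P\<close> form a word whose dimers are those of
      \<open>P\<close>.\<close>
    have m: "max_tatami (int n) (tile_h P) (tile_v P)"
      using tatami_tiles[OF P(1) assms] num_monomers_tiles[OF P(1) assms] P(2)
      by (simp add: max_tatami_def max_tatami_axioms_def)
    define q r where "q = max_tatami.q (int n) (tile_h P) (tile_v P)"
      and "r = max_tatami.r (int n) (tile_h P) (tile_v P)"
    have w: "word (int n) q r" unfolding q_def r_def by (rule max_tatami.word_qr[OF m])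
    have "tile_h P = word_h (int n) q r" "tile_v P = word_v (int n) q r"
      unfolding q_def r_def word_h_def word_v_def
      by (intro ext max_tatami.h_signs[OF m] max_tatami.v_signs[OF m])+
    then have "P = F (q, r)"
      using tiling_of_tiles[OF P(1) assms] unfolding F_def by simp
    moreover have "(q, r) \<in> words (int n)" using w unfolding words_def by simp
    ultimately show "P \<in> F ` words (int n)" by blast
  qed
  ultimately have "T n n n = card (words (int n))"
    unfolding T_def by (metis card_image)
  then show ?thesis using card_words_eq[OF assms] by simp
qed

end
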